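(* Let $\Delta$ be a finite generating set of the Thompson group $V$. (1) There are constants $c_\Delta, c'_\Delta>0$ (depending on $\Delta$) such that for all $g\in V\setminus\{\mathbf 1\}$: $$c'_\Delta\,\|g\| \ \le\ |g|_\Delta\ \le\ c_\Delta\,\|g\|\cdot\log_2\|g\| .$$ (2) For almost all $g\in V$, $$|g|_\Delta \ >\ \|g\|\cdot \log_{2|\Delta|}\|g\| ,$$ where "almost all" means: the proportion, in the set $\{g\in V:\|g\|=n\}$, of the elements that do not satisfy this inequality tends to $0$ exponentially fast as $n\to\infty$.
   Context: Let $A=\{a,b\}$ and let $A^*$ be the free monoid on $A$ (with empty word $\varepsilon$). A right ideal of $A^*$ is a subset $R$ with $RA^*\subseteq R$; it is essential if it has non-empty intersection with every (non-empty) right ideal of $A^*$. A prefix code is a set $P\subseteq A^*$ in which no element is a strict prefix of another; it is maximal if it is not strictly contained in another prefix code over $A$. Every right ideal is $PA^*$ for a unique prefix code $P$; it is finitely generated iff $P$ is finite, and essential iff $P$ is maximal. A right-ideal isomorphism is a bijection $\varphi:R_1\to R_2$ between right ideals with $\varphi(ux)=\varphi(u)x$ for all $u\in R_1,x\in A^*$; an extension of $\varphi$ is a right-ideal isomorphism $\Phi:J_1\to J_2$ with $R_i\subseteq J_i$ agreeing with $\varphi$ on $R_1$. Every isomorphism $\varphi$ between essential right ideals has a unique maximum extension, denoted $\mathsf{max}\,\varphi$. The Thompson group $V$ is the set of all maximal (i.e. without strict extension) isomorphisms between finitely generated essential right ideals of $\{a,b\}^*$, with multiplication $\varphi\cdot\psi=\mathsf{max}(\varphi\circ\psi)$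 ($\psi$ applied first; composition of partial functions); $\mathbf 1$ is the identity map on $A^*$. $V$ is finitely generated. Word length: $|g|_\Delta$ is the length of a shortest word over $\Delta^{\pm1}$ representing $g$. Table size: if $g\in V$ is the maximal isomorphism $\varphi:P_1A^*\to P_2A^*$ with $P_1,P_2$ finite maximal prefix codes, then $\|g\|=|P_1|$ $(=|P_2|)$. *)

theory Defs
  imports Complex_Main "HOL-Library.Sublist" "HOL-Algebra.Generated_Groups"
begin

datatype letter = La | Lb

type_synonym word = "letter list"

definition right_ideal :: "word set \<Rightarrow> bool" where
  "right_ideal R \<longleftrightarrow> (\<forall>u\<in>R. \<forall>x. u @ x \<in> R)"

definition essential :: "word set \<Rightarrow> bool" where
  "essential R \<longleftrightarrow> right_ideal R \<and> (\<forall>J. right_ideal J \<and> J \<noteq> {} \<longrightarrow> R \<inter> J \<noteq> {})"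

definition ideal_generated :: "word set \<Rightarrow> word set" where
  "ideal_generated P = {u @ x | u x. u \<in> P}"

definition fin_gen_ideal :: "word set \<Rightarrow> bool" where
  "fin_gen_ideal R \<longleftrightarrow> (\<exists>F. finite F \<and> R = ideal_generated F)"

definition prefix_code :: "word set \<Rightarrow> bool" where
  "prefix_code P \<longleftrightarrow> (\<forall>u\<in>P. \<forall>v\<in>P. \<not> strict_prefix u v)"

definition ideal_code :: "word set \<Rightarrow> word set" where
  "ideal_code R = (THE P. prefix_code P \<and> R = ideal_generated P)"

text \<open>A right-ideal isomorphism is a partial map on words; its source and target ideals are
  its domain and range, and extension is inclusion of partial maps.\<close>

definition ideal_iso :: "(word \<rightharpoonup> word) \<Rightarrow> bool" where
  "ideal_iso \<phi> \<longleftrightarrow>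
     right_ideal (dom \<phi>) \<and> right_ideal (ran \<phi>) \<and> inj_on \<phi> (dom \<phi>) \<and>
     (\<forall>u v x. \<phi> u = Some v \<longrightarrow> \<phi> (u @ x) = Some (v @ x))"

definition iso_extension :: "(word \<rightharpoonup> word) \<Rightarrow> (word \<rightharpoonup> word) \<Rightarrow> bool" where
  "iso_extension \<phi> \<Phi> \<longleftrightarrow> ideal_iso \<Phi> \<and> \<phi> \<subseteq>\<^sub>m \<Phi>"

definition maximal_iso :: "(word \<rightharpoonup> word) \<Rightarrow> bool" where
  "maximal_iso \<phi> \<longleftrightarrow> ideal_iso \<phi> \<and> (\<forall>\<Phi>. iso_extension \<phi> \<Phi> \<longrightarrow> \<Phi> = \<phi>)"

text \<open>The maximum extension exists and is unique when \<open>\<phi>\<close> is an isomorphism between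
  essential right ideals; elsewhere the value is unspecified.\<close>

definition max_extension :: "(word \<rightharpoonup> word) \<Rightarrow> (word \<rightharpoonup> word)" where
  "max_extension \<phi> =
     (THE \<Phi>. iso_extension \<phi> \<Phi> \<and> (\<forall>\<Psi>. iso_extension \<phi> \<Psi> \<longrightarrow> \<Psi> \<subseteq>\<^sub>m \<Phi>))"

definition thompson_V :: "(word \<rightharpoonup> word) monoid" where
  "thompson_V =
     \<lparr>carrier = {\<phi>. maximal_iso \<phi> \<and>
                    essential (dom \<phi>) \<and> fin_gen_ideal (dom \<phi>) \<and>
                    essential (ran \<phi>) \<and> fin_gen_ideal (ran \<phi>)},
      mult = (\<lambda>\<phi> \<psi>. max_extension (\<phi> \<circ>\<^sub>m \<psi>)),
      one = Some\<rparr>"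

definition table_size :: "(word \<rightharpoonup> word) \<Rightarrow> nat" where
  "table_size g = card (ideal_code (dom g))"

definition word_length :: "('g, 'm) monoid_scheme \<Rightarrow> 'g set \<Rightarrow> 'g \<Rightarrow> nat" where
  "word_length G \<Delta> g =
     (LEAST n. \<exists>ws. length ws = n \<and> set ws \<subseteq> \<Delta> \<union> (\<lambda>d. inv\<^bsub>G\<^esub> d) ` \<Delta> \<and>
                   foldr (\<lambda>x y. x \<otimes>\<^bsub>G\<^esub> y) ws \<one>\<^bsub>G\<^esub> = g)"

definition almost_all_V :: "((word \<rightharpoonup> word) \<Rightarrow> bool) \<Rightarrow> bool" where
  "almost_all_V Q \<longleftrightarrow>
     (\<exists>C r::real. 0 < C \<and> 0 < r \<and> r < 1 \<and>
        (\<forall>n. real (card {g \<in> carrier thompson_V. table_size g = n \<and> \<not> Q g})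
               / real (card {g \<in> carrier thompson_V. table_size g = n}) \<le> C * r ^ n))"

end

(*
  Lower bound: table sizes are subadditive, because the code of an intersection of two right
  ideals is contained in the union of their codes.

  Upper bound: an element with table P -> Q is the composite of "labelled tree on P" and
  "labelled tree on Q", so it suffices to bring a labelled tree with n leaves to a normal form by
  O(n log n) moves from a fixed finite list of rearrangements near the root.  A tree
  (x, (y, z)) is regarded as three stacks with right combs as contents.  Linearly many moves
  flatten a tree onto one stack, and a divide-and-conquer sort with the two other stacks as
  working space takes O(n log n) moves; the sequence of moves may depend on the tree, so no
  comparison ever has to be made by the moves themselves.

  Counting: caterpillar trees given by two paths of length n - 2, together with the permutations
  that reverse the bottom sibling pair, give 4^(n-2) (n-2)! elements of table size n, whereas at
  most 2 n^n elements have word length at most n log n to the base 2|Delta|; the quotient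
  decays like n^2 (e/4)^n.
*)

theory Submission
  imports Defs "HOL-Combinatorics.Multiset_Permutations"
begin

text \<open>Composing on the right with a fixed element acts on the addresses of a tree and leaves
  its labels alone. Rearranging a bounded pattern at the root therefore has a bounded cost however
  large the hanging subtrees are, but only what lies near the root is within reach. Stacks fit this:
  their tops are near the root, and halving the list of labels avoids the quadratic cost of
  inserting them one by one.

  Stacks need bottoms, which a tree does not provide; splitting one leaf into three creates them
  without changing the map. The tree on Q represents the identity, so the element carrying the tree
  on P to it is the given one.

  In the counting, permutations alone do not suffice, since n^n exceeds n! by a factor of about e^n.
  One free path would contribute 2^n and still lose; two independent paths, one for the domain and
  one for the range, contribute 4^n and win. The formal estimate replaces e by 3, which is still
  below 4. The labels of the bottom pair are kept fixed in reversed order because otherwise a table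
  might reduce and have a smaller size.\<close>

section \<open>Essential right ideals and maximum extensions\<close>

text \<open>By \<open>cofin_iff\<close> these are the finitely generated essential right ideals.\<close>

definition cofin :: "word set \<Rightarrow> bool" where
  "cofin R \<longleftrightarrow> right_ideal R \<and> (\<exists>k. \<forall>w. k \<le> length w \<longrightarrow> w \<in> R)"

definition min_words :: "word set \<Rightarrow> word set" where
  "min_words R = {w \<in> R. \<forall>u. strict_prefix u w \<longrightarrow> u \<notin> R}"

lemma right_idealD: "right_ideal R \<Longrightarrow> u \<in> R \<Longrightarrow> u @ x \<in> R"
  by (simp add: right_ideal_def)

lemma ex_min_prefix: "w \<in> R \<Longrightarrow> \<exists>p x. w = p @ x \<and> p \<in> min_words R"
proof (induction "length w" arbitrary: w rule: less_induct)
  case less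
  show ?case
  proof (cases "w \<in> min_words R")
    case True
    then show ?thesis by (intro exI[of _ w] exI[of _ "[]"]) simp
  next
    case False
    with less.prems obtain u where u: "strict_prefix u w" "u \<in> R"
      by (auto simp: min_words_def)
    then have "length u < length w" by (simp add: prefix_length_less)
    from less.hyps[OF this u(2)] obtain p x where "u = p @ x" "p \<in> min_words R" by auto
    with u(1) show ?thesis by (auto simp: strict_prefix_def prefix_def)
  qed
qed

lemma prefix_code_min_words: "prefix_code (min_words R)"
  by (auto simp: prefix_code_def min_words_def)

lemma min_words_Nil:
  assumes "[] \<in> R" shows "min_words R = {[]}"
proof (intro subset_antisym subsetI)
  fix w assume w: "w \<in> min_words R"
  have "w = []"
  proof (rule ccontr)
    assume "w \<noteq> []"
    then have "strict_prefix [] w" by (simp add: strict_prefix_def)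
    with w assms show False by (auto simp: min_words_def)
  qed
  then show "w \<in> {[]}" by simp
qed (use assms in \<open>auto simp: min_words_def\<close>)

lemma prefix_code_append_eqD:
  assumes "prefix_code P" "u \<in> P" "v \<in> P" "u @ x = v @ y"
  shows "u = v" "x = y"
proof -
  have "prefix u v \<or> prefix v u"
    by (metis assms(4) prefixI prefix_same_cases)
  with assms(1-3) show "u = v" by (auto simp: prefix_code_def strict_prefix_def)
  with assms(4) show "x = y" by simp
qed

lemma ideal_generated_min_words:
  assumes "right_ideal R" shows "ideal_generated (min_words R) = R"
  using ex_min_prefix[of _ R] assms
  by (fastforce simp: ideal_generated_def min_words_def right_ideal_def)

lemma min_words_ideal_generated:
  assumes "prefix_code P" shows "min_words (ideal_generated P) = P"
proof (intro subset_antisym subsetI)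
  fix w assume "w \<in> min_words (ideal_generated P)"
  then obtain u x where w: "w = u @ x" "u \<in> P" and m: "\<And>v. strict_prefix v w \<Longrightarrow> v \<notin> ideal_generated P"
    by (auto simp: min_words_def ideal_generated_def)
  have "u \<in> ideal_generated P" using w by (auto simp: ideal_generated_def intro: exI[of _ "[]"])
  with m have "\<not> strict_prefix u w" by blast
  with w show "w \<in> P" by (auto simp: strict_prefix_def)
next
  fix w assume w: "w \<in> P"
  then have "w \<in> ideal_generated P" by (auto simp: ideal_generated_def intro: exI[of _ "[]"])
  moreover have "v \<notin> ideal_generated P" if "strict_prefix v w" for v
  proof
    assume "v \<in> ideal_generated P"
    then obtain u x where "v = u @ x" "u \<in> P" by (auto simp: ideal_generated_def)
    with that have "strict_prefix u w" by (auto simp: strict_prefix_def prefix_def)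
    with assms w \<open>u \<in> P\<close> show False by (auto simp: prefix_code_def)
  qed
  ultimately show "w \<in> min_words (ideal_generated P)" by (auto simp: min_words_def)
qed

lemma ideal_code_eq_min_words:
  assumes "right_ideal R" shows "ideal_code R = min_words R"
  unfolding ideal_code_def
  by (rule the_equality)
    (auto simp: prefix_code_min_words ideal_generated_min_words assms min_words_ideal_generated)

lemma finite_words_le: "finite {w :: word. length w \<le> k}"
proof -
  have "finite (UNIV :: letter set)"
  proof (rule finite_subset)
    show "(UNIV :: letter set) \<subseteq> {La, Lb}" using letter.exhaust by auto
  qed simp
  from finite_lists_length_le[OF this] show ?thesis by simp
qed

lemma cofinD:
  assumes "cofin R" obtains k where "\<And>w. k \<le> length w \<Longrightarrow> w \<in> R"
  using assms by (auto simp: cofin_def)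

lemma cofin_right_ideal: "cofin R \<Longrightarrow> right_ideal R"
  by (simp add: cofin_def)

lemma min_words_length:
  assumes "\<And>w. k \<le> length w \<Longrightarrow> w \<in> R" "w \<in> min_words R"
  shows "length w \<le> k"
proof (rule ccontr)
  assume "\<not> length w \<le> k"
  then have "strict_prefix (take k w) w" "take k w \<in> R"
    by (auto simp: strict_prefix_def take_is_prefix intro: assms(1))
  with assms(2) show False by (auto simp: min_words_def)
qed

lemma finite_min_words: assumes "cofin R" shows "finite (min_words R)"
proof -
  from assms obtain k where k: "\<And>w. k \<le> length w \<Longrightarrow> w \<in> R" by (rule cofinD) auto
  have "min_words R \<subseteq> {w. length w \<le> k}" using min_words_length[of k R] k by blast
  with finite_words_le show ?thesis by (rule finite_subset[rotated])
qed

lemma cofin_iff: "cofin R \<longleftrightarrow> essential R \<and> fin_gen_ideal R"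
proof
  assume c: "cofin R"
  then obtain k where k: "\<And>w. k \<le> length w \<Longrightarrow> w \<in> R" by (rule cofinD) auto
  have "essential R" unfolding essential_def
  proof (intro conjI allI impI)
    fix J assume J: "right_ideal J \<and> J \<noteq> {}"
    then obtain u where "u \<in> J" by auto
    with J have "u @ replicate k La \<in> J" by (auto intro: right_idealD)
    moreover have "u @ replicate k La \<in> R" by (rule k) simp
    ultimately show "R \<inter> J \<noteq> {}" by auto
  qed (rule cofin_right_ideal[OF c])
  moreover have "fin_gen_ideal R"
    using finite_min_words[OF c] ideal_generated_min_words[OF cofin_right_ideal[OF c]]
    by (auto simp: fin_gen_ideal_def intro: exI[of _ "min_words R"])
  ultimately show "essential R \<and> fin_gen_ideal R" ..
next
  assume a: "essential R \<and> fin_gen_ideal R"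
  then obtain F where F: "finite F" "R = ideal_generated F" by (auto simp: fin_gen_ideal_def)
  define k where "k = Max (insert 0 (length ` F))"
  have le: "length u \<le> k" if "u \<in> F" for u
    unfolding k_def using F(1) that by (intro Max_ge) auto
  have "w \<in> R" if w: "k \<le> length w" for w
  proof -
    \<comment> \<open>The extensions of \<open>w\<close> form a right ideal, so \<open>R\<close>
      contains some \<open>w @ x\<close>. The generator below it is no longer than \<open>w\<close>
      and hence a prefix of \<open>w\<close>.\<close>
    have "right_ideal {w @ x | x. True}" by (auto simp: right_ideal_def)
    moreover have "{w @ x | x. True} \<noteq> {}" by auto
    ultimately have "R \<inter> {w @ x | x. True} \<noteq> {}" using a unfolding essential_def by blast
    then obtain x where "w @ x \<in> R" by auto
    with F(2) obtain u y where u: "w @ x = u @ y" "u \<in> F" by (auto simp: ideal_generated_def)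
    with le[OF u(2)] w have "prefix u w"
      by (metis order_trans prefixI prefix_length_prefix)
    then show ?thesis using F(2) u(2) by (auto simp: ideal_generated_def prefix_def)
  qed
  with a show "cofin R" by (auto simp: cofin_def essential_def)
qed

lemma cofin_mono: "cofin R \<Longrightarrow> right_ideal R' \<Longrightarrow> R \<subseteq> R' \<Longrightarrow> cofin R'"
  by (auto simp: cofin_def)

section \<open>Isomorphisms up to eventual equality, and their closure\<close>

definition table_iso :: "(word \<rightharpoonup> word) \<Rightarrow> bool" where
  "table_iso \<phi> \<longleftrightarrow> ideal_iso \<phi> \<and> cofin (dom \<phi>) \<and> cofin (ran \<phi>)"

text \<open>Elements of \<open>V\<close> are determined by their values on long words, so identities in the group are
  checked up to this relation, and \<open>closure\<close> (which equals \<open>max_extension\<close>) picks the canonical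
  representative.\<close>

definition ev_eq :: "(word \<rightharpoonup> word) \<Rightarrow> (word \<rightharpoonup> word) \<Rightarrow> bool" where
  "ev_eq f g \<longleftrightarrow> (\<exists>k. \<forall>w. k \<le> length w \<longrightarrow> f w = g w)"

definition closure :: "(word \<rightharpoonup> word) \<Rightarrow> (word \<rightharpoonup> word)" where
  "closure \<phi> w = (if \<exists>v k. \<forall>x. k \<le> length x \<longrightarrow> \<phi> (w @ x) = Some (v @ x)
     then Some (SOME v. \<exists>k. \<forall>x. k \<le> length x \<longrightarrow> \<phi> (w @ x) = Some (v @ x)) else None)"

text \<open>Two candidate values are compared at one common long extension, so the choice made in
  \<open>closure\<close> is the only possible one.\<close>

lemma closure_eq_Some:
  "closure \<phi> w = Some v \<longleftrightarrow> (\<exists>k. \<forall>x. k \<le> length x \<longrightarrow> \<phi> (w @ x) = Some (v @ x))"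
proof -
  let ?P = "\<lambda>v. \<exists>k. \<forall>x. k \<le> length x \<longrightarrow> \<phi> (w @ x) = Some (v @ x)"
  have uniq: "v = v'" if "?P v" "?P v'" for v v'
  proof -
    from that obtain k k' where "\<forall>x. k \<le> length x \<longrightarrow> \<phi> (w @ x) = Some (v @ x)"
      "\<forall>x. k' \<le> length x \<longrightarrow> \<phi> (w @ x) = Some (v' @ x)" by blast
    from this[THEN spec, of "replicate (max k k') La"] show ?thesis by simp
  qed
  show ?thesis
  proof (cases "\<exists>v. ?P v")
    case True
    then have "?P (SOME v. ?P v)" by (rule someI_ex)
    with uniq True show ?thesis unfolding closure_def by auto
  qed (auto simp: closure_def)
qed

lemma ideal_isoD:
  assumes "ideal_iso \<phi>"
  shows "right_ideal (dom \<phi>)" "right_ideal (ran \<phi>)"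
    "\<phi> u = Some v \<Longrightarrow> \<phi> (u @ x) = Some (v @ x)"
    "\<phi> u = Some v \<Longrightarrow> \<phi> u' = Some v \<Longrightarrow> u = u'"
  using assms by (auto simp: ideal_iso_def inj_on_def dom_def)

lemma ideal_isoI:
  assumes "\<And>u v x. \<phi> u = Some v \<Longrightarrow> \<phi> (u @ x) = Some (v @ x)"
    and "\<And>u u' v. \<phi> u = Some v \<Longrightarrow> \<phi> u' = Some v \<Longrightarrow> u = u'"
  shows "ideal_iso \<phi>"
  unfolding ideal_iso_def
proof (intro conjI)
  show "right_ideal (dom \<phi>)" using assms(1) by (fastforce simp: right_ideal_def dom_def)
  show "right_ideal (ran \<phi>)" using assms(1) by (fastforce simp: right_ideal_def ran_def)
  show "inj_on \<phi> (dom \<phi>)" using assms(2) by (fastforce simp: inj_on_def dom_def)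
qed (use assms(1) in blast)

lemma ideal_iso_closure:
  assumes "ideal_iso \<phi>" shows "ideal_iso (closure \<phi>)"
proof (rule ideal_isoI)
  fix u v x assume "closure \<phi> u = Some v"
  then obtain k where "\<forall>x. k \<le> length x \<longrightarrow> \<phi> (u @ x) = Some (v @ x)"
    by (auto simp: closure_eq_Some)
  then show "closure \<phi> (u @ x) = Some (v @ x)"
    unfolding closure_eq_Some by (intro exI[of _ k]) auto
next
  fix u u' v assume "closure \<phi> u = Some v" "closure \<phi> u' = Some v"
  then obtain k k' where "\<forall>x. k \<le> length x \<longrightarrow> \<phi> (u @ x) = Some (v @ x)"
      "\<forall>x. k' \<le> length x \<longrightarrow> \<phi> (u' @ x) = Some (v @ x)" unfolding closure_eq_Some by blast
  from this[THEN spec, of "replicate (max k k') La"]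
  have "u @ replicate (max k k') La = u' @ replicate (max k k') La"
    by (intro ideal_isoD(4)[OF assms]) auto
  then show "u = u'" by simp
qed

lemma map_le_closure: "ideal_iso \<phi> \<Longrightarrow> \<phi> \<subseteq>\<^sub>m closure \<phi>"
  by (auto simp: map_le_def dom_def closure_eq_Some ideal_isoD(3) intro!: sym[of "closure _ _"])

text \<open>The value of an extension at \<open>w\<close> is forced by \<open>\<phi>\<close> at the
  long words \<open>w @ x\<close>. Hence \<open>closure\<close> is the greatest extension.\<close>

lemma extension_le_closure:
  assumes "cofin (dom \<phi>)" "iso_extension \<phi> \<Psi>"
  shows "\<Psi> \<subseteq>\<^sub>m closure \<phi>"
proof -
  from assms(1) obtain k where k: "\<And>w. k \<le> length w \<Longrightarrow> w \<in> dom \<phi>" by (rule cofinD) auto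
  from assms(2) have \<Psi>: "ideal_iso \<Psi>" "\<phi> \<subseteq>\<^sub>m \<Psi>" by (auto simp: iso_extension_def)
  have "closure \<phi> w = Some v" if "\<Psi> w = Some v" for w v
    unfolding closure_eq_Some
  proof (intro exI[of _ k] allI impI)
    fix x :: word assume "k \<le> length x"
    then have "w @ x \<in> dom \<phi>" by (intro k) simp
    then have "\<phi> (w @ x) = \<Psi> (w @ x)" using \<Psi>(2) by (auto simp: map_le_def)
    with ideal_isoD(3)[OF \<Psi>(1) that] show "\<phi> (w @ x) = Some (v @ x)" by simp
  qed
  then show ?thesis by (auto simp: map_le_def)
qed

lemma max_extension_eq_closure:
  assumes "ideal_iso \<phi>" "cofin (dom \<phi>)" shows "max_extension \<phi> = closure \<phi>"
  unfolding max_extension_def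
proof (rule the_equality)
  have ext: "iso_extension \<phi> (closure \<phi>)"
    using assms by (auto simp: iso_extension_def ideal_iso_closure map_le_closure)
  then show "iso_extension \<phi> (closure \<phi>) \<and> (\<forall>\<Psi>. iso_extension \<phi> \<Psi> \<longrightarrow> \<Psi> \<subseteq>\<^sub>m closure \<phi>)"
    using extension_le_closure[OF assms(2)] by blast
  fix \<Phi> assume "iso_extension \<phi> \<Phi> \<and> (\<forall>\<Psi>. iso_extension \<phi> \<Psi> \<longrightarrow> \<Psi> \<subseteq>\<^sub>m \<Phi>)"
  with ext extension_le_closure[OF assms(2)] show "\<Phi> = closure \<phi>"
    by (blast intro: map_le_antisym)
qed

lemma maximal_iso_iff:
  assumes "cofin (dom \<phi>)" shows "maximal_iso \<phi> \<longleftrightarrow> ideal_iso \<phi> \<and> closure \<phi> = \<phi>"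
proof
  assume m: "maximal_iso \<phi>"
  then have "ideal_iso \<phi>" by (simp add: maximal_iso_def)
  moreover from this have "iso_extension \<phi> (closure \<phi>)"
    by (auto simp: iso_extension_def ideal_iso_closure map_le_closure)
  ultimately show "ideal_iso \<phi> \<and> closure \<phi> = \<phi>" using m by (auto simp: maximal_iso_def)
next
  assume "ideal_iso \<phi> \<and> closure \<phi> = \<phi>"
  moreover have "\<Phi> = \<phi>" if "iso_extension \<phi> \<Phi>" "closure \<phi> = \<phi>" for \<Phi>
    using extension_le_closure[OF assms that(1)] that
    by (auto simp: iso_extension_def intro: map_le_antisym)
  ultimately show "maximal_iso \<phi>" by (auto simp: maximal_iso_def)
qed

lemma carrier_thompson_V: "g \<in> carrier thompson_V \<longleftrightarrow> table_iso g \<and> closure g = g"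
proof -
  have "g \<in> carrier thompson_V \<longleftrightarrow> maximal_iso g \<and> cofin (dom g) \<and> cofin (ran g)"
    by (auto simp: thompson_V_def cofin_iff)
  then show ?thesis by (auto simp: table_iso_def maximal_iso_iff)
qed

lemma ev_eq_refl: "ev_eq f f"
  by (simp add: ev_eq_def)

lemma ev_eq_sym: "ev_eq f g \<Longrightarrow> ev_eq g f"
  unfolding ev_eq_def by metis

lemma ev_eq_trans: "ev_eq f g \<Longrightarrow> ev_eq g h \<Longrightarrow> ev_eq f h"
  unfolding ev_eq_def by (metis max.bounded_iff)

lemma closure_cong: assumes "ev_eq f g" shows "closure f = closure g"
proof -
  from assms obtain k where k: "\<And>w. k \<le> length w \<Longrightarrow> f w = g w" by (auto simp: ev_eq_def)
  have "(\<exists>m. \<forall>x. m \<le> length x \<longrightarrow> f (w @ x) = Some (v @ x)) \<longleftrightarrow>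
    (\<exists>m. \<forall>x. m \<le> length x \<longrightarrow> g (w @ x) = Some (v @ x))" (is "?l \<longleftrightarrow> ?r") for w v
  proof
    assume ?l
    then obtain m where "\<forall>x. m \<le> length x \<longrightarrow> f (w @ x) = Some (v @ x)" ..
    then show ?r by (intro exI[of _ "m + k"]) (simp add: k[symmetric])
  next
    assume ?r
    then obtain m where "\<forall>x. m \<le> length x \<longrightarrow> g (w @ x) = Some (v @ x)" ..
    then show ?l by (intro exI[of _ "m + k"]) (simp add: k)
  qed
  then have "closure f w = Some v \<longleftrightarrow> closure g w = Some v" for w v
    by (simp add: closure_eq_Some)
  then show ?thesis by (metis ext not_Some_eq)
qed

lemma ev_eq_closure:
  assumes "ideal_iso \<phi>" "cofin (dom \<phi>)" shows "ev_eq (closure \<phi>) \<phi>"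
proof -
  from assms(2) obtain k where "\<And>w. k \<le> length w \<Longrightarrow> w \<in> dom \<phi>" by (rule cofinD) auto
  with map_le_closure[OF assms(1)] show ?thesis by (auto simp: ev_eq_def map_le_def intro!: exI[of _ k])
qed

lemma closure_in_carrier:
  assumes "table_iso \<phi>" shows "closure \<phi> \<in> carrier thompson_V"
proof -
  have i: "ideal_iso \<phi>" "cofin (dom \<phi>)" "cofin (ran \<phi>)" using assms by (auto simp: table_iso_def)
  have le: "\<phi> \<subseteq>\<^sub>m closure \<phi>" by (rule map_le_closure[OF i(1)])
  have ic: "ideal_iso (closure \<phi>)" by (rule ideal_iso_closure[OF i(1)])
  have "cofin (dom (closure \<phi>))"
    by (rule cofin_mono[OF i(2) ideal_isoD(1)[OF ic] map_le_implies_dom_le[OF le]])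
  moreover have "ran \<phi> \<subseteq> ran (closure \<phi>)"
    using le by (force simp: map_le_def ran_def dom_def)
  then have "cofin (ran (closure \<phi>))" by (rule cofin_mono[OF i(3) ideal_isoD(2)[OF ic]])
  ultimately show ?thesis
    using closure_cong[OF ev_eq_closure[OF i(1,2)]] ic
    by (auto simp: carrier_thompson_V table_iso_def)
qed

text \<open>Whatever follows the first \<open>k\<close> letters is copied, so words shrink by at
  most \<open>k\<close>. This keeps long words long under composition.\<close>

lemma table_iso_length:
  assumes "ideal_iso \<phi>" "cofin (dom \<phi>)"
  obtains k where "\<And>w v. \<phi> w = Some v \<Longrightarrow> length w \<le> length v + k"
proof -
  from assms(2) obtain k where k: "\<And>w. k \<le> length w \<Longrightarrow> w \<in> dom \<phi>" by (rule cofinD) auto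
  have "length w \<le> length v + k" if w: "\<phi> w = Some v" for w v
  proof (cases "k \<le> length w")
    case True
    then have "take k w \<in> dom \<phi>" by (intro k) simp
    then obtain u where "\<phi> (take k w) = Some u" by auto
    from ideal_isoD(3)[OF assms(1) this, of "drop k w"] w have "v = u @ drop k w" by simp
    then show ?thesis by simp
  qed simp
  then show thesis by (rule that)
qed

section \<open>Inverses, composition and the group structure\<close>

definition pinv :: "(word \<rightharpoonup> word) \<Rightarrow> (word \<rightharpoonup> word)" where
  "pinv \<phi> v = (if v \<in> ran \<phi> then Some (SOME w. \<phi> w = Some v) else None)"

lemma pinv_eq_Some: assumes "ideal_iso \<phi>" shows "pinv \<phi> v = Some w \<longleftrightarrow> \<phi> w = Some v"
proof (cases "v \<in> ran \<phi>")
  case True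
  then have "\<exists>w. \<phi> w = Some v" by (auto simp: ran_def)
  then have "\<phi> (SOME w. \<phi> w = Some v) = Some v" by (rule someI_ex)
  with True ideal_isoD(4)[OF assms] show ?thesis by (auto simp: pinv_def)
qed (auto simp: pinv_def ran_def)

lemma table_iso_pinv: assumes "table_iso \<phi>" shows "table_iso (pinv \<phi>)"
proof -
  have i: "ideal_iso \<phi>" "cofin (dom \<phi>)" "cofin (ran \<phi>)" using assms by (auto simp: table_iso_def)
  note p = pinv_eq_Some[OF i(1)]
  have "ideal_iso (pinv \<phi>)" by (rule ideal_isoI) (auto simp: p ideal_isoD(3)[OF i(1)])
  moreover have "dom (pinv \<phi>) = ran \<phi>" by (auto simp: dom_def ran_def p)
  moreover have "ran (pinv \<phi>) = dom \<phi>" by (auto simp: dom_def ran_def p)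
  ultimately show ?thesis using i by (simp add: table_iso_def)
qed

lemma ideal_iso_comp:
  assumes "ideal_iso \<phi>" "ideal_iso \<psi>" shows "ideal_iso (\<phi> \<circ>\<^sub>m \<psi>)"
  by (rule ideal_isoI) (auto simp: map_comp_Some_iff dest: ideal_isoD(3)[OF assms(1)]
     ideal_isoD(3)[OF assms(2)] ideal_isoD(4)[OF assms(1)] ideal_isoD(4)[OF assms(2)])

lemma cofin_dom_comp:
  assumes "table_iso \<phi>" "table_iso \<psi>" shows "cofin (dom (\<phi> \<circ>\<^sub>m \<psi>))"
proof -
  have i: "ideal_iso \<phi>" "cofin (dom \<phi>)" "ideal_iso \<psi>" "cofin (dom \<psi>)"
    using assms by (auto simp: table_iso_def)
  from i(2) obtain k where k: "\<And>w. k \<le> length w \<Longrightarrow> w \<in> dom \<phi>" by (rule cofinD) auto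
  from i(4) obtain l where l: "\<And>w. l \<le> length w \<Longrightarrow> w \<in> dom \<psi>" by (rule cofinD) auto
  obtain m where m: "\<And>w v. \<psi> w = Some v \<Longrightarrow> length w \<le> length v + m"
    by (rule table_iso_length[OF i(3,4)]) auto
  have "w \<in> dom (\<phi> \<circ>\<^sub>m \<psi>)" if w: "k + l + m \<le> length w" for w
  proof -
    from w have "w \<in> dom \<psi>" by (intro l) simp
    then obtain v where v: "\<psi> w = Some v" by auto
    from m[OF v] w have "v \<in> dom \<phi>" by (intro k) simp
    with v show ?thesis by (auto simp: dom_def map_comp_Some_iff)
  qed
  with ideal_isoD(1)[OF ideal_iso_comp[OF i(1,3)]] show ?thesis unfolding cofin_def by blast
qed

lemma table_iso_comp:
  assumes "table_iso \<phi>" "table_iso \<psi>" shows "table_iso (\<phi> \<circ>\<^sub>m \<psi>)"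
proof -
  have i: "ideal_iso \<phi>" "ideal_iso \<psi>" using assms by (auto simp: table_iso_def)
  \<comment> \<open>The range is the domain of the composite of the inverses, so the result on
    domains covers it.\<close>
  have "ran (\<phi> \<circ>\<^sub>m \<psi>) = dom (pinv \<psi> \<circ>\<^sub>m pinv \<phi>)"
    by (auto simp: ran_def dom_def map_comp_Some_iff pinv_eq_Some i)
  then have "cofin (ran (\<phi> \<circ>\<^sub>m \<psi>))"
    using cofin_dom_comp[OF table_iso_pinv[OF assms(2)] table_iso_pinv[OF assms(1)]] by simp
  then show ?thesis
    using cofin_dom_comp[OF assms] ideal_iso_comp[OF i] by (simp add: table_iso_def)
qed

text \<open>The hypothesis on \<open>g\<close> sends long words to long words, where
  \<open>f\<close> and \<open>f'\<close> agree.\<close>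

lemma ev_eq_comp_left:
  assumes "ev_eq f f'" "table_iso g" shows "ev_eq (f \<circ>\<^sub>m g) (f' \<circ>\<^sub>m g)"
proof -
  have i: "ideal_iso g" "cofin (dom g)" using assms(2) by (auto simp: table_iso_def)
  obtain m where m: "\<And>w v. g w = Some v \<Longrightarrow> length w \<le> length v + m"
    by (rule table_iso_length[OF i]) auto
  from assms(1) obtain k where k: "\<And>w. k \<le> length w \<Longrightarrow> f w = f' w" by (auto simp: ev_eq_def)
  have "(f \<circ>\<^sub>m g) w = (f' \<circ>\<^sub>m g) w" if "k + m \<le> length w" for w
  proof (cases "g w")
    case (Some v)
    with m[OF Some] that show ?thesis by (simp add: k)
  qed simp
  then show ?thesis by (auto simp: ev_eq_def)
qed

lemma ev_eq_comp_right: "ev_eq g g' \<Longrightarrow> ev_eq (f \<circ>\<^sub>m g) (f \<circ>\<^sub>m g')"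
  unfolding ev_eq_def map_comp_def by metis

lemma closure_Some: "closure Some = Some"
  by (rule ext) (simp add: closure_eq_Some)

lemma table_iso_Some: "table_iso Some"
proof -
  have "ideal_iso Some" by (rule ideal_isoI) auto
  then show ?thesis by (auto simp: table_iso_def cofin_def dom_def ran_def right_ideal_def)
qed

lemma one_thompson_V: "\<one>\<^bsub>thompson_V\<^esub> = Some"
  by (simp add: thompson_V_def)

lemma mult_thompson_V:
  assumes "table_iso \<phi>" "table_iso \<psi>" shows "\<phi> \<otimes>\<^bsub>thompson_V\<^esub> \<psi> = closure (\<phi> \<circ>\<^sub>m \<psi>)"
proof -
  have "\<phi> \<otimes>\<^bsub>thompson_V\<^esub> \<psi> = max_extension (\<phi> \<circ>\<^sub>m \<psi>)" by (simp add: thompson_V_def)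
  then show ?thesis
    using max_extension_eq_closure table_iso_comp[OF assms] by (simp add: table_iso_def)
qed

lemma table_iso_closure: "table_iso \<phi> \<Longrightarrow> table_iso (closure \<phi>)"
  using closure_in_carrier carrier_thompson_V by blast

lemma ev_eq_closure': "table_iso \<phi> \<Longrightarrow> ev_eq (closure \<phi>) \<phi>"
  by (simp add: ev_eq_closure table_iso_def)

text \<open>Reductions can be postponed to the end of a computation; associativity in the group then
  follows from that of partial maps.\<close>

lemma closure_mult_closure:
  assumes "table_iso \<phi>" "table_iso \<psi>"
  shows "closure \<phi> \<otimes>\<^bsub>thompson_V\<^esub> closure \<psi> = closure (\<phi> \<circ>\<^sub>m \<psi>)"
proof -
  have "ev_eq (closure \<phi> \<circ>\<^sub>m closure \<psi>) (\<phi> \<circ>\<^sub>m \<psi>)"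
    using ev_eq_comp_left[OF ev_eq_closure'[OF assms(1)] table_iso_closure[OF assms(2)]]
      ev_eq_comp_right[OF ev_eq_closure'[OF assms(2)]] by (rule ev_eq_trans)
  then show ?thesis using assms by (simp add: mult_thompson_V table_iso_closure closure_cong)
qed

lemma map_comp_assoc: "(f \<circ>\<^sub>m g) \<circ>\<^sub>m h = f \<circ>\<^sub>m (g \<circ>\<^sub>m h)"
  by (rule ext) (simp add: map_comp_def split: option.split)

lemma group_thompson_V: "group thompson_V"
proof (rule groupI)
  fix x y assume "x \<in> carrier thompson_V" "y \<in> carrier thompson_V"
  then show "x \<otimes>\<^bsub>thompson_V\<^esub> y \<in> carrier thompson_V"
    by (simp add: carrier_thompson_V[of x] carrier_thompson_V[of y] mult_thompson_V
        closure_in_carrier table_iso_comp)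
next
  show "\<one>\<^bsub>thompson_V\<^esub> \<in> carrier thompson_V"
    by (simp add: one_thompson_V carrier_thompson_V closure_Some table_iso_Some)
next
  fix x y z assume a: "x \<in> carrier thompson_V" "y \<in> carrier thompson_V" "z \<in> carrier thompson_V"
  then have t: "table_iso x" "table_iso y" "table_iso z" and c: "closure x = x" "closure z = z"
    by (auto simp: carrier_thompson_V)
  have "x \<otimes>\<^bsub>thompson_V\<^esub> y \<otimes>\<^bsub>thompson_V\<^esub> z = closure (x \<circ>\<^sub>m y) \<otimes>\<^bsub>thompson_V\<^esub> closure z"
    by (simp add: mult_thompson_V t c)
  also have "\<dots> = closure (x \<circ>\<^sub>m (y \<circ>\<^sub>m z))"
    by (simp add: closure_mult_closure t table_iso_comp map_comp_assoc)
  also have "\<dots> = closure x \<otimes>\<^bsub>thompson_V\<^esub> closure (y \<circ>\<^sub>m z)"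
    by (simp add: closure_mult_closure t table_iso_comp)
  also have "\<dots> = x \<otimes>\<^bsub>thompson_V\<^esub> (y \<otimes>\<^bsub>thompson_V\<^esub> z)"
    by (simp add: mult_thompson_V t c)
  finally show "x \<otimes>\<^bsub>thompson_V\<^esub> y \<otimes>\<^bsub>thompson_V\<^esub> z = x \<otimes>\<^bsub>thompson_V\<^esub> (y \<otimes>\<^bsub>thompson_V\<^esub> z)" .
next
  fix x assume "x \<in> carrier thompson_V"
  then have t: "table_iso x" "closure x = x" by (auto simp: carrier_thompson_V)
  have "Some \<circ>\<^sub>m x = x" by (rule ext) (simp add: map_comp_def split: option.split)
  with t show "\<one>\<^bsub>thompson_V\<^esub> \<otimes>\<^bsub>thompson_V\<^esub> x = x"
    by (simp add: one_thompson_V mult_thompson_V table_iso_Some)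
  have "ev_eq (pinv x \<circ>\<^sub>m x) Some"
  proof -
    from t(1) have i: "ideal_iso x" "cofin (dom x)" by (auto simp: table_iso_def)
    from i(2) obtain k where k: "\<And>w. k \<le> length w \<Longrightarrow> w \<in> dom x" by (rule cofinD) auto
    have "(pinv x \<circ>\<^sub>m x) w = Some w" if "k \<le> length w" for w
      using k[OF that] by (auto simp: map_comp_Some_iff pinv_eq_Some[OF i(1)])
    then show ?thesis by (auto simp: ev_eq_def)
  qed
  then have "closure (pinv x) \<otimes>\<^bsub>thompson_V\<^esub> closure x = Some"
    using closure_cong[of "pinv x \<circ>\<^sub>m x" Some] closure_Some
    by (simp only: closure_mult_closure[OF table_iso_pinv[OF t(1)] t(1)])
  then show "\<exists>y\<in>carrier thompson_V. y \<otimes>\<^bsub>thompson_V\<^esub> x = \<one>\<^bsub>thompson_V\<^esub>"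
    using t by (auto simp: one_thompson_V intro!: bexI[of _ "closure (pinv x)"] closure_in_carrier table_iso_pinv)
qed

section \<open>Subadditivity of the table size\<close>

text \<open>Each code word \<open>q\<close> of \<open>R'\<close>, extended until it enters
  \<open>R\<close>, has a prefix in the code of \<open>R\<close>. That prefix extends
  \<open>q\<close>, as two code words of \<open>R'\<close> cannot be comparable. So passing to a
  maximum extension never increases the table.\<close>

lemma card_min_words_mono:
  assumes "cofin R" "right_ideal R'" "R \<subseteq> R'"
  shows "card (min_words R') \<le> card (min_words R)"
proof -
  define f where "f p = (SOME q. q \<in> min_words R' \<and> prefix q p)" for p
  have f: "f p = q" if "q \<in> min_words R'" "prefix q p" for p q
  proof -
    have "f p \<in> min_words R' \<and> prefix (f p) p"
      unfolding f_def by (rule someI[of _ q]) (use that in blast)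
    then show ?thesis
      using prefix_code_append_eqD(1)[OF prefix_code_min_words[of R'], of "f p" q] that
      by (metis prefixE)
  qed
  from assms(1) obtain k where k: "\<And>w. k \<le> length w \<Longrightarrow> w \<in> R" by (rule cofinD) auto
  have "min_words R' \<subseteq> f ` min_words R"
  proof
    fix q assume q: "q \<in> min_words R'"
    have "q @ replicate k La \<in> R" by (rule k) simp
    then obtain p x where px: "q @ replicate k La = p @ x" "p \<in> min_words R"
      using ex_min_prefix by blast
    then have "p \<in> R'" using assms(3) by (auto simp: min_words_def)
    then obtain q' y where q': "p = q' @ y" "q' \<in> min_words R'" using ex_min_prefix by blast
    then have "q = q'"
      using prefix_code_append_eqD(1)[OF prefix_code_min_words q q'(2), of "replicate k La" "y @ x"] px(1)
      by simp
    then have "f p = q" using q' q by (intro f) auto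
    with px(2) show "q \<in> f ` min_words R" by auto
  qed
  then show ?thesis using finite_min_words[OF assms(1)] by (rule surj_card_le[rotated])
qed

text \<open>A minimal \<open>w\<close> of the intersection has a code word of each ideal as a
  prefix. These are comparable, so the longer one lies in both ideals and equals \<open>w\<close> by
  minimality.\<close>

lemma min_words_Int_subset:
  assumes "right_ideal R" "right_ideal S"
  shows "min_words (R \<inter> S) \<subseteq> min_words R \<union> min_words S"
proof
  fix w assume w: "w \<in> min_words (R \<inter> S)"
  then have "w \<in> R" "w \<in> S" by (auto simp: min_words_def)
  then obtain p x q y where p: "w = p @ x" "p \<in> min_words R" and q: "w = q @ y" "q \<in> min_words S"
    by (metis ex_min_prefix)
  have *: "p = w \<or> q = w" if r: "r \<in> R \<inter> S" "w = r @ z" "r = p \<or> r = q" for r z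
  proof (cases "z = []")
    case False
    with r have "strict_prefix r w" by (auto simp: strict_prefix_def)
    with w r(1) show ?thesis by (auto simp: min_words_def)
  qed (use r in auto)
  have "p \<in> R" "q \<in> S" using p(2) q(2) by (auto simp: min_words_def)
  moreover have "prefix p q \<or> prefix q p" using p(1) q(1) by (metis prefixI prefix_same_cases)
  ultimately have "p \<in> R \<inter> S \<or> q \<in> R \<inter> S"
    using assms by (auto simp: prefix_def right_ideal_def)
  with *[of p x] *[of q y] p q show "w \<in> min_words R \<union> min_words S" by auto
qed

text \<open>A strict prefix of \<open>v\<close> in the intersection would pull back to a strict
  prefix of \<open>p\<close>.\<close>

lemma ideal_iso_min_words:
  assumes "ideal_iso \<phi>" "right_ideal R" "p \<in> min_words {w. \<exists>v\<in>R. \<phi> w = Some v}" "\<phi> p = Some v"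
  shows "v \<in> min_words (ran \<phi> \<inter> R)"
proof -
  have v: "v \<in> ran \<phi> \<inter> R" using assms(3,4) by (auto simp: min_words_def ran_def)
  have False if u: "strict_prefix u v" "u \<in> ran \<phi>" "u \<in> R" for u
  proof -
    from u(2) obtain w where w: "\<phi> w = Some u" by (auto simp: ran_def)
    from u(1) obtain x where x: "v = u @ x" "x \<noteq> []" by (auto simp: strict_prefix_def prefix_def)
    have "p = w @ x" using ideal_isoD(3)[OF assms(1) w, of x] x assms(1,4) by (auto intro: ideal_isoD(4))
    then have "strict_prefix w p" using x by (auto simp: strict_prefix_def)
    with assms(3) w u(3) show False by (auto simp: min_words_def)
  qed
  with v show ?thesis by (auto simp: min_words_def)
qed

lemma card_min_words_preimage:
  assumes "ideal_iso \<phi>" "cofin (ran \<phi>)" "cofin R"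
  shows "card (min_words {w. \<exists>v\<in>R. \<phi> w = Some v}) \<le> card (min_words (ran \<phi> \<inter> R))"
proof (rule card_inj_on_le)
  let ?M = "min_words {w. \<exists>v\<in>R. \<phi> w = Some v}"
  have M: "\<exists>v. \<phi> p = Some v" if "p \<in> ?M" for p using that by (auto simp: min_words_def)
  show "inj_on (\<lambda>p. the (\<phi> p)) ?M"
  proof (rule inj_onI)
    fix p q assume "p \<in> ?M" "q \<in> ?M" "the (\<phi> p) = the (\<phi> q)"
    with M[of p] M[of q] show "p = q" using ideal_isoD(4)[OF assms(1)] by auto
  qed
  show "(\<lambda>p. the (\<phi> p)) ` ?M \<subseteq> min_words (ran \<phi> \<inter> R)"
  proof
    fix v assume "v \<in> (\<lambda>p. the (\<phi> p)) ` ?M"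
    then obtain p where "p \<in> ?M" "v = the (\<phi> p)" by auto
    with M[of p] show "v \<in> min_words (ran \<phi> \<inter> R)"
      using ideal_iso_min_words[OF assms(1) cofin_right_ideal[OF assms(3)]] by auto
  qed
  show "finite (min_words (ran \<phi> \<inter> R))"
    using min_words_Int_subset[OF cofin_right_ideal[OF assms(2)] cofin_right_ideal[OF assms(3)]]
      finite_min_words[OF assms(2)] finite_min_words[OF assms(3)]
    by (meson finite_UnI finite_subset)
qed

lemma cofin_UNIV: "cofin UNIV"
  by (auto simp: cofin_def right_ideal_def)

text \<open>This is the preimage bound for the partial inverse and the ideal of all words.\<close>

lemma card_min_words_ran:
  assumes "table_iso \<phi>" shows "card (min_words (ran \<phi>)) \<le> card (min_words (dom \<phi>))"
proof -
  have i: "ideal_iso \<phi>" using assms by (auto simp: table_iso_def)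
  have p: "table_iso (pinv \<phi>)" by (rule table_iso_pinv[OF assms])
  have "{v. \<exists>w\<in>UNIV. pinv \<phi> v = Some w} = ran \<phi>" "ran (pinv \<phi>) = dom \<phi>"
    by (auto simp: pinv_eq_Some[OF i] ran_def)
  with card_min_words_preimage[of "pinv \<phi>" UNIV] p cofin_UNIV show ?thesis
    by (simp add: table_iso_def)
qed

lemma table_size_eq: "table_iso g \<Longrightarrow> table_size g = card (min_words (dom g))"
  by (simp add: table_size_def ideal_code_eq_min_words table_iso_def cofin_def)

lemma table_size_mult:
  assumes "g \<in> carrier thompson_V" "h \<in> carrier thompson_V"
  shows "table_size (g \<otimes>\<^bsub>thompson_V\<^esub> h) \<le> table_size g + table_size h"
proof -
  have t: "table_iso g" "table_iso h" using assms by (auto simp: carrier_thompson_V)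
  then have i: "ideal_iso g" "cofin (dom g)" "ideal_iso h" "cofin (ran h)" by (auto simp: table_iso_def)
  have tc: "table_iso (g \<circ>\<^sub>m h)" by (rule table_iso_comp[OF t])
  then have c: "ideal_iso (g \<circ>\<^sub>m h)" "cofin (dom (g \<circ>\<^sub>m h))" by (auto simp: table_iso_def)
  have "table_size (g \<otimes>\<^bsub>thompson_V\<^esub> h) = card (min_words (dom (closure (g \<circ>\<^sub>m h))))"
    by (simp add: mult_thompson_V t table_size_eq table_iso_closure tc)
  also have "\<dots> \<le> card (min_words (dom (g \<circ>\<^sub>m h)))"
    by (rule card_min_words_mono[OF c(2) ideal_isoD(1)[OF ideal_iso_closure[OF c(1)]]
        map_le_implies_dom_le[OF map_le_closure[OF c(1)]]])
  also have "dom (g \<circ>\<^sub>m h) = {w. \<exists>v\<in>dom g. h w = Some v}"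
    by (auto simp: dom_def map_comp_Some_iff)
  also have "card (min_words \<dots>) \<le> card (min_words (ran h \<inter> dom g))"
    by (rule card_min_words_preimage[OF i(3,4,2)])
  also have "\<dots> \<le> card (min_words (ran h) \<union> min_words (dom g))"
    by (intro card_mono min_words_Int_subset) (auto simp: finite_min_words i cofin_right_ideal)
  also have "\<dots> \<le> card (min_words (ran h)) + card (min_words (dom g))" by (rule card_Un_le)
  also have "\<dots> \<le> table_size g + table_size h"
    using card_min_words_ran[OF t(2)] by (simp add: table_size_eq t)
  finally show ?thesis .
qed

lemma table_size_one: "table_size Some = 1"
  by (simp add: min_words_Nil table_size_eq table_iso_Some dom_def)

section \<open>Words over the generators and the linear lower bound\<close>

abbreviation list_prod :: "('a, 'm) monoid_scheme \<Rightarrow> 'a list \<Rightarrow> 'a" where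
  "list_prod G ws \<equiv> foldr (\<lambda>x y. x \<otimes>\<^bsub>G\<^esub> y) ws \<one>\<^bsub>G\<^esub>"

abbreviation sym_closure :: "('a, 'm) monoid_scheme \<Rightarrow> 'a set \<Rightarrow> 'a set" where
  "sym_closure G \<Delta> \<equiv> \<Delta> \<union> (\<lambda>d. inv\<^bsub>G\<^esub> d) ` \<Delta>"

context group
begin

lemma list_prod_closed: "set ws \<subseteq> carrier G \<Longrightarrow> list_prod G ws \<in> carrier G"
  by (induction ws) auto

lemma list_prod_append:
  "set us \<subseteq> carrier G \<Longrightarrow> set ws \<subseteq> carrier G \<Longrightarrow>
    list_prod G (us @ ws) = list_prod G us \<otimes> list_prod G ws"
  by (induction us) (auto simp: list_prod_closed m_assoc)

lemma sym_closure_carrier: "\<Delta> \<subseteq> carrier G \<Longrightarrow> sym_closure G \<Delta> \<subseteq> carrier G"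
  by auto

lemma generate_imp_word:
  assumes "\<Delta> \<subseteq> carrier G" "h \<in> generate G \<Delta>"
  shows "\<exists>ws. set ws \<subseteq> sym_closure G \<Delta> \<and> list_prod G ws = h"
  using assms(2)
proof induction
  case one
  then show ?case by (intro exI[of _ "[]"]) simp
next
  case (incl h)
  with assms(1) show ?case by (intro exI[of _ "[h]"]) auto
next
  case (inv h)
  with assms(1) show ?case by (intro exI[of _ "[inv h]"]) auto
next
  case (eng h1 h2)
  then obtain us ws where "set us \<subseteq> sym_closure G \<Delta>" "list_prod G us = h1"
    "set ws \<subseteq> sym_closure G \<Delta>" "list_prod G ws = h2" by blast
  with sym_closure_carrier[OF assms(1)] show ?case
    by (intro exI[of _ "us @ ws"] conjI) (use list_prod_append[of us ws] in auto)
qed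

lemma word_length_le:
  "set ws \<subseteq> sym_closure G \<Delta> \<Longrightarrow> list_prod G ws = g \<Longrightarrow> word_length G \<Delta> g \<le> length ws"
  unfolding word_length_def by (rule Least_le) blast

lemma word_length_word:
  assumes "\<Delta> \<subseteq> carrier G" "g \<in> generate G \<Delta>"
  obtains ws where "set ws \<subseteq> sym_closure G \<Delta>" "list_prod G ws = g" "length ws = word_length G \<Delta> g"
proof -
  have "\<exists>n ws. length ws = n \<and> set ws \<subseteq> sym_closure G \<Delta> \<and> list_prod G ws = g"
    using generate_imp_word[OF assms] by blast
  from LeastI_ex[OF this] show thesis using that unfolding word_length_def by blast
qed

lemma word_length_mult:
  assumes "\<Delta> \<subseteq> carrier G" "g \<in> generate G \<Delta>" "h \<in> generate G \<Delta>"
  shows "word_length G \<Delta> (g \<otimes> h) \<le> word_length G \<Delta> g + word_length G \<Delta> h"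
proof -
  obtain us where us: "set us \<subseteq> sym_closure G \<Delta>" "list_prod G us = g" "length us = word_length G \<Delta> g"
    by (rule word_length_word[OF assms(1,2)])
  obtain ws where ws: "set ws \<subseteq> sym_closure G \<Delta>" "list_prod G ws = h" "length ws = word_length G \<Delta> h"
    by (rule word_length_word[OF assms(1,3)])
  have "word_length G \<Delta> (g \<otimes> h) \<le> length (us @ ws)"
    using us(1,2) ws(1,2) sym_closure_carrier[OF assms(1)] list_prod_append[of us ws]
    by (intro word_length_le) auto
  with us(3) ws(3) show ?thesis by simp
qed

end

lemma word_length_lower:
  assumes "finite \<Delta>" "\<Delta> \<subseteq> carrier thompson_V" "generate thompson_V \<Delta> = carrier thompson_V"
  shows "\<exists>c'::real. c' > 0 \<and> (\<forall>g\<in>carrier thompson_V - {\<one>\<^bsub>thompson_V\<^esub>}.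
     c' * real (table_size g) \<le> real (word_length thompson_V \<Delta> g))"
proof -
  interpret group thompson_V by (rule group_thompson_V)
  define M where "M = Max (insert 0 (table_size ` sym_closure thompson_V \<Delta>))"
  have M: "table_size d \<le> M" if "d \<in> sym_closure thompson_V \<Delta>" for d
    unfolding M_def using assms(1) that by (intro Max_ge) auto
  have size: "table_size (list_prod thompson_V ws) \<le> 1 + M * length ws"
    if "set ws \<subseteq> sym_closure thompson_V \<Delta>" for ws
    using that
  proof (induction ws)
    case Nil
    then show ?case by (simp add: one_thompson_V table_size_one)
  next
    case (Cons d ws)
    have "d \<in> carrier thompson_V" "set ws \<subseteq> carrier thompson_V"
      using Cons.prems sym_closure_carrier[OF assms(2)] by auto
    then have "table_size (list_prod thompson_V (d # ws)) \<le> table_size d + table_size (list_prod thompson_V ws)"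
      by (simp add: table_size_mult list_prod_closed)
    also have "\<dots> \<le> M + (1 + M * length ws)" using Cons M by (intro add_mono) auto
    finally show ?case by simp
  qed
  have "1 / real (M + 1) * real (table_size g) \<le> real (word_length thompson_V \<Delta> g)"
    if g: "g \<in> carrier thompson_V - {\<one>\<^bsub>thompson_V\<^esub>}" for g
  proof -
    obtain ws where ws: "set ws \<subseteq> sym_closure thompson_V \<Delta>" "list_prod thompson_V ws = g"
      "length ws = word_length thompson_V \<Delta> g"
      by (rule word_length_word[OF assms(2)]) (use g assms(3) in auto)
    \<comment> \<open>The summand 1 in \<open>size\<close> is the table size of the identity; a
      nonempty word absorbs it, which is why the identity is excluded.\<close>
    have "ws \<noteq> []" using ws(2) g by auto
    then have "table_size g \<le> (M + 1) * length ws"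
      using size[OF ws(1)] ws(2) by (cases ws) auto
    then have "real (table_size g) \<le> real ((M + 1) * length ws)" by (rule of_nat_mono)
    then show ?thesis using ws(3) by (simp add: field_simps)
  qed
  moreover have "1 / real (M + 1) > 0" by simp
  ultimately show ?thesis by blast
qed

section \<open>Labelled trees and moves at the root\<close>

text \<open>A tree is read as a table: the addresses of the leaves form the domain code, and the label of
  a leaf is the image of its address.\<close>

datatype tree = L word | N tree tree

fun sem :: "tree \<Rightarrow> word \<Rightarrow> word option" where
  "sem (L l) w = Some (l @ w)"
| "sem (N a b) [] = None"
| "sem (N a b) (La # w) = sem a w"
| "sem (N a b) (Lb # w) = sem b w"

fun leaves :: "tree \<Rightarrow> word list" where
  "leaves (L l) = [l]"
| "leaves (N a b) = leaves a @ leaves b"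

lemma length_leaves_pos: "0 < length (leaves t)"
  by (induction t) auto

lemma sem_append: "sem t w = Some v \<Longrightarrow> sem t (w @ x) = Some (v @ x)"
  by (induction t w rule: sem.induct) auto

lemma sem_total: "\<exists>k. \<forall>w. k \<le> length w \<longrightarrow> w \<in> dom (sem t)"
proof (induction t)
  case (L l)
  then show ?case by (auto simp: dom_def)
next
  case (N a b)
  then obtain k m where k: "\<And>w. k \<le> length w \<Longrightarrow> w \<in> dom (sem a)"
    and m: "\<And>w. m \<le> length w \<Longrightarrow> w \<in> dom (sem b)" by blast
  have "w \<in> dom (sem (N a b))" if w: "Suc (k + m) \<le> length w" for w
  proof (cases w)
    case (Cons c w')
    with w k[of w'] m[of w'] show ?thesis by (cases c) (auto simp: dom_def)
  qed (use w in simp)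
  then show ?case by blast
qed

lemma sem_SomeD: "sem t w = Some v \<Longrightarrow> \<exists>l\<in>set (leaves t). \<exists>x. v = l @ x"
  by (induction t w rule: sem.induct) auto

lemma leaf_in_ran_sem: "l \<in> set (leaves t) \<Longrightarrow> l @ x \<in> ran (sem t)"
proof (induction t)
  case (L l)
  then have "sem (L l) x = Some (l @ x)" by simp
  with L show ?case by (auto simp: ran_def)
next
  case (N a b)
  have "ran (sem a) \<subseteq> ran (sem (N a b))" "ran (sem b) \<subseteq> ran (sem (N a b))"
    by (auto simp: ran_def intro: exI[of _ "La # _"] exI[of _ "Lb # _"])
  with N show ?case by auto
qed

lemma ran_sem: "ran (sem t) = ideal_generated (set (leaves t))"
  using sem_SomeD[of t] leaf_in_ran_sem[of _ t] by (fastforce simp: ideal_generated_def ran_def)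

text \<open>Values from different subtrees extend different labels, and distinct words of a prefix
  code have no common extension.\<close>

lemma sem_inj:
  assumes "distinct (leaves t)" "prefix_code (set (leaves t))" "sem t w = Some v" "sem t w' = Some v"
  shows "w = w'"
  using assms
proof (induction t arbitrary: w w')
  case (L l)
  then have "l @ w = l @ w'" by simp
  then show ?case by simp
next
  case (N a b)
  have code: "prefix_code (set (leaves a))" "prefix_code (set (leaves b))"
    using N.prems(2) by (auto simp: prefix_code_def)
  have no: False if "sem a u = Some v" "sem b u' = Some v" for u u'
  proof -
    from that obtain l l' x x' where "l \<in> set (leaves a)" "v = l @ x" "l' \<in> set (leaves b)" "v = l' @ x'"
      by (blast dest: sem_SomeD)
    with prefix_code_append_eqD(1)[OF N.prems(2), of l l' x x'] N.prems(1) show False by auto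
  qed
  obtain c u where w: "w = c # u" using N.prems(3) by (cases w) auto
  obtain c' u' where w': "w' = c' # u'" using N.prems(4) by (cases w') auto
  have d: "distinct (leaves a)" "distinct (leaves b)" using N.prems(1) by auto
  show ?case
  proof (cases "c = c'")
    case True
    then have "u = u'"
      using N.IH(1)[OF d(1) code(1), of u u'] N.IH(2)[OF d(2) code(2), of u u'] N.prems(3,4)
      unfolding w w' by (cases c') fastforce+
    with True show ?thesis by (simp add: w w')
  next
    case False
    then show ?thesis using no[of u u'] no[of u' u] N.prems(3,4)
      unfolding w w' by (cases c; cases c') auto
  qed
qed

lemma table_iso_sem:
  assumes "distinct (leaves t)" "prefix_code (set (leaves t))" "cofin (ideal_generated (set (leaves t)))"
  shows "table_iso (sem t)"
proof -
  have i: "ideal_iso (sem t)" by (rule ideal_isoI[OF sem_append sem_inj[OF assms(1,2)]])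
  then have "cofin (dom (sem t))" using sem_total[of t] ideal_isoD(1)[OF i] unfolding cofin_def by simp
  with i assms(3) show ?thesis by (simp add: table_iso_def ran_sem)
qed

lemma right_ideal_generated: "right_ideal (ideal_generated P)"
  by (fastforce simp: right_ideal_def ideal_generated_def)

text \<open>No label in the five moves is longer than three, so that they cover all long words is a
  finite case split.\<close>

lemma table_iso_sem_small:
  assumes "distinct (leaves t)" "prefix_code (set (leaves t))"
    and "\<And>c d e x. \<exists>l\<in>set (leaves t). prefix l (c # d # e # x)"
  shows "table_iso (sem t)"
proof (rule table_iso_sem[OF assms(1,2)])
  have "w \<in> ideal_generated (set (leaves t))" if "3 \<le> length w" for w
  proof -
    from that obtain c d e x where "w = c # d # e # x"
      by (auto simp: numeral_3_eq_3 Suc_le_length_iff)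
    with assms(3)[of c d e x] show ?thesis by (auto simp: ideal_generated_def prefix_def)
  qed
  then show "cofin (ideal_generated (set (leaves t)))"
    using right_ideal_generated by (auto simp: cofin_def)
qed

text \<open>The move turning a pattern into another one sends the address of each subtree in the first
  pattern to its address in the second one; the patterns are listed in \<open>sem_moves\<close>.\<close>

definition swap_move where "swap_move = N (L [Lb]) (L [La])"
definition rot_move where "rot_move = N (N (L [La]) (L [Lb, La])) (L [Lb, Lb])"
definition exch_move where "exch_move = N (L [Lb, La]) (N (L [La]) (L [Lb, Lb]))"
definition push_move where
  "push_move = N (N (L [Lb, La, La]) (L [La])) (N (L [Lb, La, Lb]) (L [Lb, Lb]))"
definition split_move where
  "split_move = N (N (N (L [La, La]) (L [La, Lb, La])) (L [La, Lb, Lb])) (L [Lb])"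

lemmas move_defs = swap_move_def rot_move_def exch_move_def push_move_def split_move_def

lemma table_iso_moves:
  "table_iso (sem swap_move)" "table_iso (sem rot_move)" "table_iso (sem exch_move)"
  "table_iso (sem push_move)" "table_iso (sem split_move)"
proof -
  have "\<exists>l\<in>set (leaves swap_move). prefix l (c # d # e # x)" for c d e x
    by (cases c; simp add: swap_move_def)
  then show "table_iso (sem swap_move)"
    by (intro table_iso_sem_small) (simp_all add: swap_move_def prefix_code_def strict_prefix_def)
  have "\<exists>l\<in>set (leaves rot_move). prefix l (c # d # e # x)" for c d e x
    by (cases c; cases d; simp add: rot_move_def)
  then show "table_iso (sem rot_move)"
    by (intro table_iso_sem_small) (simp_all add: rot_move_def prefix_code_def strict_prefix_def)
  have "\<exists>l\<in>set (leaves exch_move). prefix l (c # d # e # x)" for c d e x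
    by (cases c; cases d; simp add: exch_move_def)
  then show "table_iso (sem exch_move)"
    by (intro table_iso_sem_small) (simp_all add: exch_move_def prefix_code_def strict_prefix_def)
  have "\<exists>l\<in>set (leaves push_move). prefix l (c # d # e # x)" for c d e x
    by (cases c; cases d; cases e; simp add: push_move_def)
  then show "table_iso (sem push_move)"
    by (intro table_iso_sem_small) (simp_all add: push_move_def prefix_code_def strict_prefix_def)
  have "\<exists>l\<in>set (leaves split_move). prefix l (c # d # e # x)" for c d e x
    by (cases c; cases d; cases e; simp add: split_move_def)
  then show "table_iso (sem split_move)"
    by (intro table_iso_sem_small) (simp_all add: split_move_def prefix_code_def strict_prefix_def)
qed

lemma ev_eqI3:
  assumes "\<And>c d e w. f (c # d # e # w) = g (c # d # e # w)" shows "ev_eq f g"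
  unfolding ev_eq_def
proof (intro exI[of _ 3] allI impI)
  fix w :: word assume "3 \<le> length w"
  then obtain c d e x where "w = c # d # e # x"
    by (auto simp: numeral_3_eq_3 Suc_le_length_iff)
  with assms show "f w = g w" by simp
qed

lemma sem_moves:
  "ev_eq (sem (N a b)) (sem (N b a) \<circ>\<^sub>m sem swap_move)"
  "ev_eq (sem (N (N a b) c)) (sem (N a (N b c)) \<circ>\<^sub>m sem rot_move)"
  "ev_eq (sem (N a (N b c))) (sem (N b (N a c)) \<circ>\<^sub>m sem exch_move)"
  "ev_eq (sem (N (N a x) (N y z))) (sem (N x (N (N a y) z)) \<circ>\<^sub>m sem push_move)"
  "ev_eq (sem (N (N (N a b) x) y)) (sem (N (N a (N b x)) y) \<circ>\<^sub>m sem split_move)"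
proof -
  show "ev_eq (sem (N a b)) (sem (N b a) \<circ>\<^sub>m sem swap_move)"
    by (rule ev_eqI3, rename_tac p q r w, case_tac p) (auto simp: move_defs)
  show "ev_eq (sem (N (N a b) c)) (sem (N a (N b c)) \<circ>\<^sub>m sem rot_move)"
    by (rule ev_eqI3, rename_tac p q r w, case_tac p; case_tac q) (auto simp: move_defs)
  show "ev_eq (sem (N a (N b c))) (sem (N b (N a c)) \<circ>\<^sub>m sem exch_move)"
    by (rule ev_eqI3, rename_tac p q r w, case_tac p; case_tac q) (auto simp: move_defs)
  show "ev_eq (sem (N (N a x) (N y z))) (sem (N x (N (N a y) z)) \<circ>\<^sub>m sem push_move)"
    by (rule ev_eqI3, rename_tac p q r w, case_tac p; case_tac q) (auto simp: move_defs)
  show "ev_eq (sem (N (N (N a b) x) y)) (sem (N (N a (N b x)) y) \<circ>\<^sub>m sem split_move)"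
    by (rule ev_eqI3, rename_tac p q r w, case_tac p; case_tac q; case_tac r) (auto simp: move_defs)
qed

section \<open>Rearrangements of trees and their cost\<close>

lemma (in group) word_length_inv:
  assumes "\<Delta> \<subseteq> carrier G" "g \<in> generate G \<Delta>"
  shows "word_length G \<Delta> (inv g) \<le> word_length G \<Delta> g"
proof -
  obtain ws where ws: "set ws \<subseteq> sym_closure G \<Delta>" "list_prod G ws = g" "length ws = word_length G \<Delta> g"
    by (rule word_length_word[OF assms])
  have *: "list_prod G (rev (map (\<lambda>x. inv x) us)) = inv (list_prod G us)"
    if "set us \<subseteq> carrier G" for us
    using that
  proof (induction us)
    case (Cons u us)
    have "list_prod G (rev (map (\<lambda>x. inv x) us) @ [inv u]) =
        list_prod G (rev (map (\<lambda>x. inv x) us)) \<otimes> list_prod G [inv u]"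
      using Cons.prems by (intro list_prod_append) auto
    with Cons show ?case by (simp add: inv_mult_group list_prod_closed)
  qed simp
  have "inv x \<in> sym_closure G \<Delta>" if "x \<in> sym_closure G \<Delta>" for x
    using that
  proof
    assume "x \<in> (\<lambda>d. inv d) ` \<Delta>"
    then obtain d where "d \<in> \<Delta>" "x = inv d" by blast
    with assms(1) show ?thesis by (simp add: subset_iff)
  qed simp
  then have "set (rev (map (\<lambda>x. inv x) ws)) \<subseteq> sym_closure G \<Delta>"
    using ws(1) unfolding set_rev set_map by (meson image_subsetI subsetD)
  moreover have "set ws \<subseteq> carrier G"
    using ws(1) sym_closure_carrier[OF assms(1)] by (rule order_trans)
  ultimately have "word_length G \<Delta> (inv g) \<le> length (rev (map (\<lambda>x. inv x) ws))"
    using * ws(2) by (intro word_length_le) auto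
  with ws(3) show ?thesis by simp
qed

locale generating_set =
  fixes \<Delta> :: "(word \<rightharpoonup> word) set"
  assumes carr: "\<Delta> \<subseteq> carrier thompson_V"
    and gen: "generate thompson_V \<Delta> = carrier thompson_V"
begin

sublocale group thompson_V by (rule group_thompson_V)

definition unit_cost :: nat where
  "unit_cost = Max ((\<lambda>m. word_length thompson_V \<Delta> (closure (sem m))) `
     {swap_move, rot_move, exch_move, push_move, split_move})"

text \<open>Precomposition, because \<open>g\<close> is to move addresses and keep labels. The
  number \<open>n\<close> of moves is only an upper bound, so estimates may be padded.\<close>

definition reach :: "nat \<Rightarrow> tree \<Rightarrow> tree \<Rightarrow> bool" where
  "reach n t u \<longleftrightarrow> (\<exists>g\<in>carrier thompson_V. word_length thompson_V \<Delta> g \<le> unit_cost * n \<and>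
     ev_eq (sem t) (sem u \<circ>\<^sub>m g))"

lemma reachI_ev_eq: assumes "ev_eq (sem t) (sem u)" shows "reach 0 t u"
proof -
  have "word_length thompson_V \<Delta> \<one>\<^bsub>thompson_V\<^esub> \<le> length ([] :: (word \<rightharpoonup> word) list)"
    by (rule word_length_le) auto
  moreover have "sem u \<circ>\<^sub>m Some = sem u" by (rule ext) simp
  ultimately show ?thesis unfolding reach_def using assms
    by (intro bexI[of _ "\<one>\<^bsub>thompson_V\<^esub>"] one_closed) (auto simp: one_thompson_V)
qed

lemma reach_refl: "reach 0 t t"
  by (rule reachI_ev_eq[OF ev_eq_refl])

lemma reach_mono: "reach m t u \<Longrightarrow> m \<le> n \<Longrightarrow> reach n t u"
  unfolding reach_def by (meson le_trans mult_le_mono2)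

lemma ev_eq_mult:
  "g \<in> carrier thompson_V \<Longrightarrow> h \<in> carrier thompson_V \<Longrightarrow> ev_eq (g \<otimes>\<^bsub>thompson_V\<^esub> h) (g \<circ>\<^sub>m h)"
  by (simp add: carrier_thompson_V mult_thompson_V ev_eq_closure' table_iso_comp)

lemma reach_trans [trans]: assumes "reach m t u" "reach n u z" shows "reach (m + n) t z"
proof -
  from assms obtain g h where g: "g \<in> carrier thompson_V"
    "word_length thompson_V \<Delta> g \<le> unit_cost * m" "ev_eq (sem t) (sem u \<circ>\<^sub>m g)"
    and h: "h \<in> carrier thompson_V" "word_length thompson_V \<Delta> h \<le> unit_cost * n"
    "ev_eq (sem u) (sem z \<circ>\<^sub>m h)"
    unfolding reach_def by blast
  have "ev_eq (sem u \<circ>\<^sub>m g) (sem z \<circ>\<^sub>m (h \<circ>\<^sub>m g))"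
    using ev_eq_comp_left[OF h(3)] g(1) by (simp add: carrier_thompson_V map_comp_assoc)
  moreover have "ev_eq (sem z \<circ>\<^sub>m (h \<circ>\<^sub>m g)) (sem z \<circ>\<^sub>m (h \<otimes>\<^bsub>thompson_V\<^esub> g))"
    by (intro ev_eq_comp_right ev_eq_sym[OF ev_eq_mult] g h)
  ultimately have "ev_eq (sem t) (sem z \<circ>\<^sub>m (h \<otimes>\<^bsub>thompson_V\<^esub> g))"
    using g(3) by (blast intro: ev_eq_trans)
  moreover have "word_length thompson_V \<Delta> (h \<otimes>\<^bsub>thompson_V\<^esub> g) \<le> unit_cost * (m + n)"
    using word_length_mult[OF carr, of h g] g h by (simp add: gen algebra_simps)
  ultimately show ?thesis using g(1) h(1) unfolding reach_def by blast
qed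

lemma reach_sym: assumes "reach m t u" shows "reach m u t"
proof -
  from assms obtain g where g: "g \<in> carrier thompson_V"
    "word_length thompson_V \<Delta> g \<le> unit_cost * m" "ev_eq (sem t) (sem u \<circ>\<^sub>m g)"
    unfolding reach_def by blast
  let ?h = "inv\<^bsub>thompson_V\<^esub> g"
  have h: "?h \<in> carrier thompson_V" using g(1) by simp
  have "table_iso ?h" using h by (simp only: carrier_thompson_V)
  then have 1: "ev_eq (sem t \<circ>\<^sub>m ?h) (sem u \<circ>\<^sub>m (g \<circ>\<^sub>m ?h))"
    using ev_eq_comp_left[OF g(3)] by (simp only: map_comp_assoc)
  have "ev_eq (g \<circ>\<^sub>m ?h) Some"
    using ev_eq_sym[OF ev_eq_mult[OF g(1) h]] by (simp only: r_inv[OF g(1)] one_thompson_V)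
  then have 2: "ev_eq (sem u \<circ>\<^sub>m (g \<circ>\<^sub>m ?h)) (sem u \<circ>\<^sub>m Some)" by (rule ev_eq_comp_right)
  have "sem u \<circ>\<^sub>m Some = sem u" by (rule ext) simp
  then have "ev_eq (sem u) (sem t \<circ>\<^sub>m ?h)"
    using ev_eq_sym[OF ev_eq_trans[OF 1 2]] by (simp only:)
  moreover have "word_length thompson_V \<Delta> ?h \<le> unit_cost * m"
    using word_length_inv[OF carr, of g] g by (simp add: gen)
  ultimately show ?thesis using h unfolding reach_def by blast
qed

lemma reach_move:
  assumes "m \<in> {swap_move, rot_move, exch_move, push_move, split_move}"
    and "ev_eq (sem t) (sem u \<circ>\<^sub>m sem m)"
  shows "reach 1 t u"
proof -
  have t: "table_iso (sem m)" using assms(1) table_iso_moves by auto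
  have "word_length thompson_V \<Delta> (closure (sem m)) \<le> unit_cost"
    unfolding unit_cost_def using assms(1) by (intro Max_ge) auto
  moreover have "ev_eq (sem u \<circ>\<^sub>m sem m) (sem u \<circ>\<^sub>m closure (sem m))"
    by (intro ev_eq_comp_right ev_eq_sym[OF ev_eq_closure'] t)
  ultimately show ?thesis
    unfolding reach_def
    by (intro bexI[OF _ closure_in_carrier[OF t]] conjI ev_eq_trans[OF assms(2)]) simp_all
qed

text \<open>In terms of stacks, \<open>reach_push\<close> moves the top of the first stack onto the
  second, and \<open>reach_split\<close> cuts a tree on top of the first stack into two
  entries.\<close>

lemma reach_swap: "reach 1 (N a b) (N b a)"
  and reach_rot: "reach 1 (N (N a b) c) (N a (N b c))"
  and reach_exch: "reach 1 (N a (N b c)) (N b (N a c))"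
  and reach_push: "reach 1 (N (N a x) (N y z)) (N x (N (N a y) z))"
  and reach_split: "reach 1 (N (N (N a b) x) y) (N (N a (N b x)) y)"
  by (rule reach_move[OF _ sem_moves(1)] reach_move[OF _ sem_moves(2)] reach_move[OF _ sem_moves(3)]
     reach_move[OF _ sem_moves(4)] reach_move[OF _ sem_moves(5)]; simp)+

lemma reach_cycle: "reach 2 (N x (N y z)) (N y (N z x))"
  using reach_trans[OF reach_swap reach_rot] by (simp add: numeral_2_eq_2)

lemma reach_exch13: "reach 3 (N x (N y z)) (N z (N y x))"
  using reach_trans[OF reach_cycle reach_exch] by simp

lemma reach_exch23: "reach 5 (N x (N y z)) (N x (N z y))"
  using reach_trans[OF reach_cycle reach_exch13] by simp

text \<open>A push onto the third stack: the last two stacks are exchanged before and after an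
  ordinary push, which costs 5 + 1 + 5.\<close>

lemma reach_push3: "reach 11 (N (N a x) (N y z)) (N x (N y (N a z)))"
  using reach_trans[OF reach_trans[OF reach_exch23 reach_push] reach_exch23] by simp

fun comb :: "tree list \<Rightarrow> tree \<Rightarrow> tree" where
  "comb [] s = s"
| "comb (x # xs) s = N x (comb xs s)"

lemma comb_append: "comb (xs @ ys) s = comb xs (comb ys s)"
  by (induction xs) auto

section \<open>Sorting with three stacks\<close>

text \<open>Only the contents of the two piles matter, since both are sorted afterwards. The dearer
  kind of push costs 11.\<close>

lemma reach_distribute:
  assumes "mset xs = A + B"
  shows "\<exists>as bs. mset as = A \<and> mset bs = B \<and>
    reach (11 * length xs) (N (comb xs x) (N y z)) (N x (N (comb bs y) (comb as z)))"
  using assms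
proof (induction xs arbitrary: y z A B)
  case Nil
  then show ?case by (intro exI[of _ "[]"]) (auto intro: reach_refl)
next
  case (Cons e xs)
  have "e \<in># A + B" using Cons.prems[symmetric] by simp
  then consider "e \<in># A" | "e \<in># B" by auto
  then show ?case
  proof cases
    case 1
    then obtain A' where A: "A = add_mset e A'" by (rule mset_add)
    with Cons.prems have "mset xs = A' + B" by simp
    from Cons.IH[OF this, of y "N e z"] obtain as bs where ab: "mset as = A'" "mset bs = B"
      "reach (11 * length xs) (N (comb xs x) (N y (N e z))) (N x (N (comb bs y) (comb as (N e z))))"
      by blast
    from reach_trans[OF reach_push3 ab(3)] ab(1,2) A show ?thesis
      by (intro exI[of _ "as @ [e]"] exI[of _ bs]) (simp add: comb_append)
  next
    case 2
    then obtain B' where B: "B = add_mset e B'" by (rule mset_add)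
    with Cons.prems have "mset xs = A + B'" by simp
    from Cons.IH[OF this, of "N e y" z] obtain as bs where ab: "mset as = A" "mset bs = B'"
      "reach (11 * length xs) (N (comb xs x) (N (N e y) z)) (N x (N (comb bs (N e y)) (comb as z)))"
      by blast
    from reach_mono[OF reach_trans[OF reach_push ab(3)], of "11 * length (e # xs)"] ab(1,2) B
    show ?thesis
      by (intro exI[of _ as] exI[of _ "bs @ [e]"]) (simp add: comb_append)
  qed
qed

lemma reach_reverse:
  "reach (length xs) (N (comb xs x) (N y z)) (N x (N (comb (rev xs) y) z))"
proof (induction xs arbitrary: y)
  case Nil
  then show ?case by (simp add: reach_refl)
next
  case (Cons e xs)
  from reach_trans[OF reach_push Cons.IH[of "N e y"]] show ?case by (simp add: comb_append)
qed

text \<open>The entries of the first half of \<open>ys\<close> are sent to the third stack and the others to the second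
  one. The latter are sorted (in reverse) back onto the first stack and moved over, and then the
  former are sorted on top of them.\<close>

lemma reach_sort:
  assumes "mset xs = mset ys" "length ys \<le> 2 ^ k"
  shows "reach (20 * (k + 1) * length ys) (N (comb xs x) (N y z)) (N x (N (comb ys y) z))"
  using assms
proof (induction k arbitrary: xs ys x y z)
  case 0
  have len: "length xs = length ys" using 0(1) by (rule mset_eq_length)
  \<comment> \<open>With at most one entry, moving the stack over already sorts it.\<close>
  have "rev xs = ys"
  proof (cases ys)
    case (Cons e es)
    with 0 have "ys = [e]" by simp
    with 0(1) show ?thesis by simp
  qed (use 0 in simp)
  with reach_reverse[of xs x y z]
  have "reach (length xs) (N (comb xs x) (N y z)) (N x (N (comb ys y) z))" by simp
  then show ?case by (rule reach_mono) (use len in simp)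
next
  case (Suc k)
  show ?case
  proof (cases "ys = []")
    case True
    with Suc.prems have "xs = []" by simp
    with True show ?thesis using reach_refl[of "N x (N y z)"] by simp
  next
    case False
    define us where "us = take (2 ^ k) ys"
    define vs where "vs = drop (2 ^ k) ys"
    have ys: "ys = us @ vs" by (simp add: us_def vs_def)
    have len: "length us \<le> 2 ^ k" "length vs \<le> 2 ^ k"
      using Suc.prems(2) by (auto simp: us_def vs_def)
    have "mset xs = mset us + mset vs" using Suc.prems(1) ys by simp
    from reach_distribute[OF this, of x y z] obtain as bs where
      ab: "mset as = mset us" "mset bs = mset vs" and
      d: "reach (11 * length xs) (N (comb xs x) (N y z)) (N x (N (comb bs y) (comb as z)))" by blast
    note d
    also note reach_exch
    \<comment> \<open>The target order is reversed because the transfer by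
      \<open>reach_reverse\<close> flips it again.\<close>
    also have "reach (20 * (k + 1) * length (rev vs)) (N (comb bs y) (N x (comb as z)))
        (N y (N (comb (rev vs) x) (comb as z)))"
      by (rule Suc.IH) (simp_all add: ab len)
    also note reach_exch
    also note reach_reverse
    also note reach_exch13
    \<comment> \<open>The sorted block of \<open>vs\<close> counts here as part of the bottom of the
      target stack; for this the induction leaves the bottoms arbitrary.\<close>
    also have "reach (20 * (k + 1) * length us) (N (comb as z) (N (comb (rev (rev vs)) y) x))
        (N z (N (comb us (comb (rev (rev vs)) y)) x))"
      by (rule Suc.IH) (simp_all add: ab len)
    also note reach_exch13
    \<comment> \<open>One level costs at most 11 per entry for the distribution, 1 per entry for the
      reversal, and 1 + 1 + 3 + 3 = 8 exchanges, which a nonempty list absorbs. This is the constant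
      20.\<close>
    finally have "reach (11 * length xs + 1 + 20 * (k + 1) * length (rev vs) + 1 + length (rev vs) + 3 +
         20 * (k + 1) * length us + 3) (N (comb xs x) (N y z)) (N x (N (comb ys y) z))"
      by (simp add: ys comb_append)
    moreover have "length xs = length ys" using Suc.prems(1) by (rule mset_eq_length)
    moreover have "length ys = length us + length vs" "length ys \<ge> 1" using ys False by (auto simp: Suc_le_eq)
    ultimately show ?thesis by (elim reach_mono) (simp add: algebra_simps)
  qed
qed

text \<open>One split per inner node and one push per leaf give (n - 1) + n moves. Left subtrees are
  pushed first and end up lower, hence the reversal.\<close>

lemma reach_flatten:
  "reach (2 * length (leaves t) - 1) (N (N t x) (N y z)) (N x (N (comb (map L (rev (leaves t))) y) z))"
proof (induction t arbitrary: x y)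
  case (L l)
  then show ?case using reach_push by simp
next
  case (N a b)
  note reach_split
  also note N.IH(1)
  also note N.IH(2)
  finally have "reach (1 + (2 * length (leaves a) - 1) + (2 * length (leaves b) - 1))
      (N (N (N a b) x) (N y z)) (N x (N (comb (map L (rev (leaves (N a b)))) y) z))"
    by (simp add: comb_append)
  then show ?case
    by (rule reach_mono)
      (insert length_leaves_pos[of a] length_leaves_pos[of b],
        simp del: length_greater_0_conv)
qed

end

section \<open>The normal form of a labelled tree\<close>

context generating_set
begin

text \<open>Each step towards the leaf takes at most two moves and shifts a subtree with at least
  one leaf into \<open>c\<close>, so the cost is linear. As \<open>c\<close> grows, it is arbitrary
  in the induction.\<close>

lemma reach_extract:
  assumes "l \<in> set (leaves a)"
  shows "\<exists>u. add_mset l (mset (leaves u)) = mset (leaves (N a c)) \<and>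
     reach (3 * length (leaves a)) (N a c) (N (L l) u)"
  using assms
proof (induction a arbitrary: c)
  case (L l')
  then show ?case by (intro exI[of _ c]) (simp add: reach_mono[OF reach_refl])
next
  case (N a b)
  show ?case
  proof (cases "l \<in> set (leaves a)")
    case True
    from N.IH(1)[OF this, of "N b c"] obtain u where
      u: "add_mset l (mset (leaves u)) = mset (leaves (N a (N b c)))"
      "reach (3 * length (leaves a)) (N a (N b c)) (N (L l) u)" by blast
    have "reach (1 + 3 * length (leaves a)) (N (N a b) c) (N (L l) u)"
      by (rule reach_trans[OF reach_rot u(2)])
    then have "reach (3 * length (leaves (N a b))) (N (N a b) c) (N (L l) u)"
      by (rule reach_mono) (insert length_leaves_pos[of b], simp del: length_greater_0_conv)
    with u(1) show ?thesis by (intro exI[of _ u]) (simp add: ac_simps)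
  next
    case False
    with N.prems have "l \<in> set (leaves b)" by simp
    from N.IH(2)[OF this, of "N a c"] obtain u where
      u: "add_mset l (mset (leaves u)) = mset (leaves (N b (N a c)))"
      "reach (3 * length (leaves b)) (N b (N a c)) (N (L l) u)" by blast
    have "reach (1 + 1 + 3 * length (leaves b)) (N (N a b) c) (N (L l) u)"
      by (rule reach_trans[OF reach_trans[OF reach_rot reach_exch] u(2)])
    then have "reach (3 * length (leaves (N a b))) (N (N a b) c) (N (L l) u)"
      by (rule reach_mono) (insert length_leaves_pos[of a], simp del: length_greater_0_conv)
    with u(1) show ?thesis by (intro exI[of _ u]) (simp add: ac_simps)
  qed
qed

text \<open>The leaf \<open>l\<close> is brought to the top and split into three leaves, which serve as the bottoms of
  the stacks.\<close>

lemma reach_normal_form: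
  assumes "mset (leaves t) = add_mset l (mset ys)" "ys \<noteq> []" "length (leaves t) \<le> 2 ^ k"
  shows "reach ((20 * k + 30) * length (leaves t)) t
    (N (L (l @ [Lb, La])) (N (comb (map L ys) (L (l @ [La]))) (L (l @ [Lb, Lb]))))"
proof -
  let ?n = "length (leaves t)"
  have n: "?n = Suc (length ys)" using assms(1) by (metis mset.simps(2) size_mset length_Cons)
  with assms(2) have "t \<noteq> L l'" for l' by auto
  then obtain a b where t: "t = N a b" by (cases t) auto
  have l: "l \<in> set (leaves t)" using assms(1) by (metis set_mset_mset union_single_eq_member)
  have "\<exists>u. add_mset l (mset (leaves u)) = mset (leaves t) \<and> reach (1 + 3 * ?n) t (N (L l) u)"
  proof (cases "l \<in> set (leaves a)")
    case True
    from reach_extract[OF this, of b] obtain u where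
      u: "add_mset l (mset (leaves u)) = mset (leaves t)"
      "reach (3 * length (leaves a)) t (N (L l) u)" unfolding t by blast
    from u(2) have "reach (1 + 3 * ?n) t (N (L l) u)" by (rule reach_mono) (simp add: t)
    with u(1) show ?thesis by blast
  next
    case False
    with l have "l \<in> set (leaves b)" by (simp add: t)
    from reach_extract[OF this, of a] obtain u where
      u: "add_mset l (mset (leaves u)) = mset (leaves t)"
      "reach (3 * length (leaves b)) (N b a) (N (L l) u)" unfolding t by (auto simp: ac_simps)
    have "reach (1 + 3 * length (leaves b)) t (N (L l) u)"
      unfolding t by (rule reach_trans[OF reach_swap u(2)])
    then have "reach (1 + 3 * ?n) t (N (L l) u)" by (rule reach_mono) (simp add: t)
    with u(1) show ?thesis by blast
  qed
  then obtain u where u: "mset (leaves u) = mset ys" "reach (1 + 3 * ?n) t (N (L l) u)"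
    using assms(1) by auto
  let ?p = "L (l @ [La])" and ?q = "L (l @ [Lb, La])" and ?r = "L (l @ [Lb, Lb])"
  have leaf: "sem (N ?p (N ?q ?r)) (c # d # w) = sem (L l) (c # d # w)" for c d w
    by (cases c; cases d) simp_all
  \<comment> \<open>Expanding a leaf changes the map on short words only, so it is free.\<close>
  have expand: "reach 0 (N (L l) u) (N (N ?p (N ?q ?r)) u)"
  proof (intro reachI_ev_eq ev_eqI3)
    fix c d e w
    show "sem (N (L l) u) (c # d # e # w) = sem (N (N ?p (N ?q ?r)) u) (c # d # e # w)"
      using leaf[of d e w] by (cases c) simp_all
  qed
  note u(2)
  also note expand
  also note reach_swap
  \<comment> \<open>This lays \<open>u\<close> on the stack with bottom \<open>?p\<close>, as
    \<open>reach_flatten\<close> requires.\<close>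
  also note reach_sym[OF reach_rot]
  also note reach_flatten
  also note reach_exch
  also have "reach (20 * (k + 1) * length (map L ys))
      (N (comb (map L (rev (leaves u))) ?q) (N ?p ?r)) (N ?q (N (comb (map L ys) ?p) ?r))"
    by (rule reach_sort) (use u(1) assms(3) n in simp_all)
  \<comment> \<open>The 30 consists of 20 from the sort, 3 from extracting the leaf, 2 from
    flattening, and room for the single moves.\<close>
  finally show ?thesis
    by (rule reach_mono)
      (use n mset_eq_length[OF u(1)] in \<open>simp add: algebra_simps\<close>)
qed

end

section \<open>From tables to trees\<close>

lemma tree_exists:
  assumes "right_ideal R" "\<And>w. k \<le> length w \<Longrightarrow> w \<in> R"
  shows "\<exists>t. (\<forall>p\<in>min_words R. \<forall>x. sem t (p @ x) = Some (f p @ x)) \<and>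
     mset (leaves t) = image_mset f (mset_set (min_words R))"
  using assms
proof (induction k arbitrary: R f)
  case 0
  then have "min_words R = {[]}" by (simp add: min_words_Nil)
  then show ?case by (intro exI[of _ "L (f [])"]) simp
next
  case (Suc k)
  show ?case
  proof (cases "[] \<in> R")
    case True
    then have "min_words R = {[]}" by (rule min_words_Nil)
    then show ?thesis by (intro exI[of _ "L (f [])"]) simp
  next
    case False
    \<comment> \<open>The quotients of \<open>R\<close> by a first letter have codes that become the
      two subtrees; \<open>k\<close> bounds the depth and drops by one.\<close>
    define S where "S c = {w. c # w \<in> R}" for c
    have S: "right_ideal (S c)" "\<And>w. k \<le> length w \<Longrightarrow> w \<in> S c" for c
      using Suc.prems by (auto simp: right_ideal_def S_def)
    then have fin: "finite (min_words (S c))" for c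
      by (intro finite_min_words) (auto simp: cofin_def)
    have mw: "c # w \<in> min_words R \<longleftrightarrow> w \<in> min_words (S c)" for c w
    proof -
      have "(\<forall>u. strict_prefix u (c # w) \<longrightarrow> u \<notin> R) \<longleftrightarrow> (\<forall>u. strict_prefix u w \<longrightarrow> c # u \<notin> R)"
      proof (intro iffI allI impI)
        fix u assume a: "\<forall>u. strict_prefix u w \<longrightarrow> c # u \<notin> R" "strict_prefix u (c # w)"
        show "u \<notin> R"
        proof (cases u)
          case (Cons d u')
          with a show ?thesis by (auto simp: strict_prefix_def)
        qed (use False in simp)
      qed (auto simp: strict_prefix_def)
      then show ?thesis by (auto simp: min_words_def S_def)
    qed
    have eq: "min_words R = (#) La ` min_words (S La) \<union> (#) Lb ` min_words (S Lb)"
    proof (intro subset_antisym subsetI)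
      fix w assume w: "w \<in> min_words R"
      with False obtain c v where v: "w = c # v" by (cases w) (auto simp: min_words_def)
      with w mw have "v \<in> min_words (S c)" by simp
      with v show "w \<in> (#) La ` min_words (S La) \<union> (#) Lb ` min_words (S Lb)" by (cases c) auto
    qed (auto simp: mw)
    obtain a where a: "\<And>p x. p \<in> min_words (S La) \<Longrightarrow> sem a (p @ x) = Some (f (La # p) @ x)"
      "mset (leaves a) = image_mset (\<lambda>p. f (La # p)) (mset_set (min_words (S La)))"
      using Suc.IH[OF S, of La, where f = "\<lambda>p. f (La # p)"] by blast
    obtain b where b: "\<And>p x. p \<in> min_words (S Lb) \<Longrightarrow> sem b (p @ x) = Some (f (Lb # p) @ x)"
      "mset (leaves b) = image_mset (\<lambda>p. f (Lb # p)) (mset_set (min_words (S Lb)))"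
      using Suc.IH[OF S, of Lb, where f = "\<lambda>p. f (Lb # p)"] by blast
    have "mset_set (min_words R) = mset_set ((#) La ` min_words (S La)) + mset_set ((#) Lb ` min_words (S Lb))"
      unfolding eq by (rule mset_set_Union) (auto simp: fin)
    also have "\<dots> = image_mset ((#) La) (mset_set (min_words (S La))) + image_mset ((#) Lb) (mset_set (min_words (S Lb)))"
      by (simp add: image_mset_mset_set)
    finally have "mset (leaves (N a b)) = image_mset f (mset_set (min_words R))"
      by (simp add: a(2) b(2) multiset.map_comp comp_def)
    moreover have "sem (N a b) (p @ x) = Some (f p @ x)" if "p \<in> min_words R" for p x
      using that a(1) b(1) unfolding eq by auto
    ultimately show ?thesis by blast
  qed
qed

lemma tree_of_map:
  assumes "cofin R" "\<And>p x. p \<in> min_words R \<Longrightarrow> g (p @ x) = Some (f p @ x)"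
  obtains t where "ev_eq (sem t) g" "mset (leaves t) = image_mset f (mset_set (min_words R))"
proof -
  from assms(1) obtain k where k: "\<And>w. k \<le> length w \<Longrightarrow> w \<in> R" by (rule cofinD) auto
  from tree_exists[OF cofin_right_ideal[OF assms(1)] k, where f = f] obtain t where
    t: "\<And>p x. p \<in> min_words R \<Longrightarrow> sem t (p @ x) = Some (f p @ x)"
    "mset (leaves t) = image_mset f (mset_set (min_words R))" by blast
  have "sem t w = g w" if "k \<le> length w" for w
  proof -
    from ex_min_prefix[OF k[OF that]] obtain p x where "w = p @ x" "p \<in> min_words R" by blast
    with t(1) assms(2) show ?thesis by simp
  qed
  then have "ev_eq (sem t) g" by (auto simp: ev_eq_def)
  with t(2) show thesis by (rule that[rotated])
qed

lemma image_min_words: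
  assumes "ideal_iso g" shows "(\<lambda>p. the (g p)) ` min_words (dom g) = min_words (ran g)"
proof (intro subset_antisym subsetI)
  have dom: "{w. \<exists>v\<in>UNIV. g w = Some v} = dom g" by auto
  fix v assume "v \<in> (\<lambda>p. the (g p)) ` min_words (dom g)"
  then obtain p where p: "p \<in> min_words (dom g)" "v = the (g p)" by blast
  then have "g p = Some v" by (auto simp: min_words_def)
  with ideal_iso_min_words[OF assms, of UNIV p v] p(1) show "v \<in> min_words (ran g)"
    unfolding dom by (simp add: right_ideal_def)
next
  have ran: "{v. \<exists>w\<in>UNIV. pinv g v = Some w} = ran g" "ran (pinv g) = dom g"
    by (auto simp: pinv_eq_Some[OF assms] ran_def)
  have inv: "ideal_iso (pinv g)"
    by (rule ideal_isoI) (auto simp: pinv_eq_Some[OF assms] dest: ideal_isoD(3)[OF assms])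
  fix v assume v: "v \<in> min_words (ran g)"
  then obtain p where p: "g p = Some v" by (auto simp: min_words_def ran_def)
  then have "pinv g v = Some p" by (simp add: pinv_eq_Some[OF assms])
  with ideal_iso_min_words[OF inv, of UNIV v p] v have "p \<in> min_words (dom g)"
    unfolding ran by (simp add: right_ideal_def)
  with p show "v \<in> (\<lambda>p. the (g p)) ` min_words (dom g)" by force
qed

text \<open>Both trees are labelled by the range code of \<open>g\<close>: \<open>t\<close> at the
  addresses of the preimages, \<open>s\<close> at the words themselves.\<close>

lemma two_trees:
  assumes "g \<in> carrier thompson_V"
  obtains s t where "ev_eq (sem t) g" "ev_eq (sem s) Some" "mset (leaves t) = mset (leaves s)"
    "length (leaves t) = table_size g"
proof -
  from assms have tg: "table_iso g" and i: "ideal_iso g" "cofin (dom g)" "cofin (ran g)"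
    by (auto simp: carrier_thompson_V table_iso_def)
  have gp: "g (p @ x) = Some (the (g p) @ x)" if "p \<in> min_words (dom g)" for p x
    using that ideal_isoD(3)[OF i(1)] by (auto simp: min_words_def)
  obtain t where t: "ev_eq (sem t) g"
    "mset (leaves t) = image_mset (\<lambda>p. the (g p)) (mset_set (min_words (dom g)))"
    by (rule tree_of_map[OF i(2) gp])
  obtain s where s: "ev_eq (sem s) Some" "mset (leaves s) = image_mset (\<lambda>p. p) (mset_set (min_words (ran g)))"
    by (rule tree_of_map[OF i(3), where f = "\<lambda>p. p" and g = Some]) auto
  have "inj_on (\<lambda>p. the (g p)) (min_words (dom g))"
  proof (rule inj_onI)
    fix p q assume "p \<in> min_words (dom g)" "q \<in> min_words (dom g)" "the (g p) = the (g q)"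
    with gp[of p "[]"] gp[of q "[]"] show "p = q" using ideal_isoD(4)[OF i(1)] by simp
  qed
  then have "mset (leaves t) = mset_set (min_words (ran g))"
    by (simp add: t(2) image_mset_mset_set image_min_words[OF i(1)])
  with s(2) have "mset (leaves t) = mset (leaves s)" by simp
  moreover have "length (leaves t) = table_size g"
    using arg_cong[OF t(2), of size] by (simp add: table_size_eq[OF tg])
  ultimately show thesis using t(1) s(1) by (intro that)
qed

lemma carrier_eqI:
  "g \<in> carrier thompson_V \<Longrightarrow> h \<in> carrier thompson_V \<Longrightarrow> ev_eq g h \<Longrightarrow> g = h"
  using closure_cong[of g h] by (simp add: carrier_thompson_V)

text \<open>With fewer than two leaves, \<open>t\<close> and \<open>s\<close> are the same single
  leaf. The bound keeps the logarithm at least 1 in the upper estimate.\<close>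

lemma table_size_ge_2:
  assumes "g \<in> carrier thompson_V" "g \<noteq> Some" shows "2 \<le> table_size g"
proof (rule ccontr)
  assume "\<not> 2 \<le> table_size g"
  obtain s t where st: "ev_eq (sem t) g" "ev_eq (sem s) Some" "mset (leaves t) = mset (leaves s)"
    "length (leaves t) = table_size g" by (rule two_trees[OF assms(1)])
  have leaf: "\<exists>l. u = L l" if "length (leaves u) < 2" for u
  proof (cases u)
    case (N a b)
    with that length_leaves_pos[of a] length_leaves_pos[of b] show ?thesis by simp
  qed auto
  have "length (leaves s) = length (leaves t)" using st(3) by (metis size_mset)
  with st(3,4) leaf[of s] leaf[of t] \<open>\<not> 2 \<le> table_size g\<close> have "t = s" by auto
  with st(1,2) have "ev_eq g Some" by (blast intro: ev_eq_trans ev_eq_sym)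
  moreover have "Some \<in> carrier thompson_V"
    by (simp add: carrier_thompson_V closure_Some table_iso_Some)
  ultimately show False using carrier_eqI[OF assms(1)] assms(2) by blast
qed

section \<open>The n log n upper bound\<close>

context generating_set
begin

lemma word_length_upper_nat:
  assumes "g \<in> carrier thompson_V" "g \<noteq> Some" "table_size g \<le> 2 ^ k"
  shows "word_length thompson_V \<Delta> g \<le> unit_cost * (2 * ((20 * k + 30) * table_size g))"
proof -
  obtain s t where st: "ev_eq (sem t) g" "ev_eq (sem s) Some" "mset (leaves t) = mset (leaves s)"
    "length (leaves t) = table_size g" by (rule two_trees[OF assms(1)])
  have ls: "length (leaves s) = table_size g" using st(3,4) by (metis size_mset)
  obtain l ys where l: "leaves t = l # ys" using length_leaves_pos[of t] by (cases "leaves t") auto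
  have ys: "ys \<noteq> []" using l st(4) table_size_ge_2[OF assms(1,2)] by auto
  have "reach ((20 * k + 30) * table_size g) t
    (N (L (l @ [Lb, La])) (N (comb (map L ys) (L (l @ [La]))) (L (l @ [Lb, Lb]))))"
    by (rule reach_normal_form[of t l ys k, unfolded st(4)]) (use l ys assms(3) in simp_all)
  moreover have "reach ((20 * k + 30) * table_size g) s
    (N (L (l @ [Lb, La])) (N (comb (map L ys) (L (l @ [La]))) (L (l @ [Lb, Lb]))))"
    by (rule reach_normal_form[of s l ys k, unfolded ls]) (use l ys st(3) assms(3) in simp_all)
  \<comment> \<open>The normal form depends only on \<open>l\<close> and \<open>ys\<close>, so it is
    common to \<open>t\<close> and \<open>s\<close>.\<close>
  ultimately have "reach ((20 * k + 30) * table_size g + (20 * k + 30) * table_size g) t s"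
    by (rule reach_trans[OF _ reach_sym])
  then obtain h where h: "h \<in> carrier thompson_V" "ev_eq (sem t) (sem s \<circ>\<^sub>m h)"
    "word_length thompson_V \<Delta> h \<le> unit_cost * ((20 * k + 30) * table_size g + (20 * k + 30) * table_size g)"
    unfolding reach_def by blast
  have "table_iso h" using h(1) by (simp add: carrier_thompson_V)
  then have "ev_eq (sem s \<circ>\<^sub>m h) (Some \<circ>\<^sub>m h)" by (rule ev_eq_comp_left[OF st(2)])
  moreover have "Some \<circ>\<^sub>m h = h" by (rule ext) (simp add: map_comp_def split: option.split)
  ultimately have "ev_eq (sem s \<circ>\<^sub>m h) h" by simp
  then have "ev_eq g h" by (rule ev_eq_trans[OF ev_eq_sym[OF st(1)] ev_eq_trans[OF h(2)]])
  with assms(1) h(1) have "g = h" by (rule carrier_eqI)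
  with h(3) show ?thesis by (simp add: mult_2)
qed

lemma word_length_upper:
  "\<exists>c::real. c > 0 \<and> (\<forall>g\<in>carrier thompson_V - {\<one>\<^bsub>thompson_V\<^esub>}.
     real (word_length thompson_V \<Delta> g) \<le> c * real (table_size g) * log 2 (real (table_size g)))"
proof -
  have "real (word_length thompson_V \<Delta> g)
      \<le> (140 * real unit_cost + 1) * real (table_size g) * log 2 (real (table_size g))"
    if g: "g \<in> carrier thompson_V - {\<one>\<^bsub>thompson_V\<^esub>}" for g
  proof -
    let ?n = "table_size g"
    have g': "g \<in> carrier thompson_V" "g \<noteq> Some" using g by (auto simp: one_thompson_V)
    have n: "2 \<le> ?n" by (rule table_size_ge_2[OF g'])
    let ?lg = "log 2 (real ?n)"
    have lg: "1 \<le> ?lg" using n by simp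
    define k where "k = nat \<lceil>?lg\<rceil>"
    have k: "?lg \<le> real k" "real k \<le> ?lg + 1" using lg unfolding k_def by linarith+
    have "real ?n \<le> 2 powr real k" using k(1) n by (simp add: log_le_iff)
    then have "real ?n \<le> real (2 ^ k)" by (simp add: powr_realpow)
    then have "?n \<le> 2 ^ k" by (simp only: of_nat_le_iff)
    from word_length_upper_nat[OF g' this]
    have "real (word_length thompson_V \<Delta> g) \<le> real (unit_cost * (2 * ((20 * k + 30) * ?n)))"
      by (rule of_nat_mono)
    also have "\<dots> = real unit_cost * real ?n * (40 * real k + 60)" by (simp add: algebra_simps)
    \<comment> \<open>40 k + 60 is at most 40 lg + 100, hence at most 140 lg because lg is at least
      1.\<close>
    also have "\<dots> \<le> real unit_cost * real ?n * (140 * ?lg)"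
      using k(2) lg by (intro mult_left_mono) auto
    also have "\<dots> \<le> (140 * real unit_cost + 1) * real ?n * ?lg"
      using lg by (simp add: algebra_simps)
    finally show ?thesis .
  qed
  \<comment> \<open>The added 1 makes the constant positive whatever \<open>unit_cost\<close>
    is.\<close>
  then show ?thesis by (intro exI[of _ "140 * real unit_cost + 1"]) auto
qed

end

section \<open>Counting\<close>

fun flip :: "letter \<Rightarrow> letter" where
  "flip La = Lb"
| "flip Lb = La"

fun side_words :: "letter list \<Rightarrow> word list" where
  "side_words [] = []"
| "side_words (d # ds) = [flip d] # map ((#) d) (side_words ds)"

text \<open>The code of the caterpillar tree whose spine follows the path \<open>ds\<close>.\<close>

definition spine_words :: "letter list \<Rightarrow> word list" where
  "spine_words ds = side_words ds @ [ds @ [La], ds @ [Lb]]"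

fun spine :: "letter list \<Rightarrow> word list \<Rightarrow> tree \<Rightarrow> tree" where
  "spine (La # ds) (x # xs) t = N (spine ds xs t) (L x)"
| "spine (Lb # ds) (x # xs) t = N (L x) (spine ds xs t)"
| "spine _ _ t = t"

lemma length_side_words [simp]: "length (side_words ds) = length ds"
  by (induction ds) auto

lemma spine_words_Cons: "spine_words (d # ds) = [flip d] # map ((#) d) (spine_words ds)"
  by (simp add: spine_words_def)

lemma distinct_spine_words: "distinct (spine_words ds)"
proof (induction ds)
  case (Cons d ds)
  then show ?case by (cases d) (auto simp: spine_words_Cons distinct_map)
qed (simp add: spine_words_def)

lemma prefix_code_spine_words: "prefix_code (set (spine_words ds))"
proof (induction ds)
  case (Cons d ds)
  then show ?case
    by (cases d) (auto simp: spine_words_Cons prefix_code_def strict_prefix_def)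
qed (simp add: spine_words_def prefix_code_def strict_prefix_def)

text \<open>A word that is not a prefix of the path leaves it sideways or runs past its end, and so
  passes a code word. The ideal thus determines the path.\<close>

lemma spine_words_prefix_iff: "(\<exists>u\<in>set (spine_words ds). prefix u w) \<longleftrightarrow> \<not> prefix w ds"
proof (induction ds arbitrary: w)
  case Nil
  show ?case
  proof (cases w)
    case (Cons c w')
    then show ?thesis by (cases c) (auto simp: spine_words_def)
  qed (simp add: spine_words_def)
next
  case (Cons d ds)
  show ?case
  proof (cases w)
    case Nil
    then show ?thesis by (auto simp: spine_words_Cons)
  next
    case (Cons c w')
    with Cons.IH[of w'] show ?thesis
      by (cases c; cases d) (auto simp: spine_words_Cons)
  qed
qed

lemma ideal_generated_spine_words: "ideal_generated (set (spine_words ds)) = {w. \<not> prefix w ds}"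
proof -
  have "ideal_generated (set (spine_words ds)) = {w. \<exists>u\<in>set (spine_words ds). prefix u w}"
    by (auto simp: ideal_generated_def prefix_def)
  then show ?thesis by (simp add: spine_words_prefix_iff)
qed

lemma cofin_spine_words: "cofin (ideal_generated (set (spine_words ds)))"
proof -
  have "w \<in> ideal_generated (set (spine_words ds))" if "Suc (length ds) \<le> length w" for w
    using that prefix_length_le[of w ds] by (auto simp: ideal_generated_spine_words)
  then show ?thesis using right_ideal_generated by (auto simp: cofin_def)
qed

lemma leaves_spine:
  "length xs = length ds \<Longrightarrow> mset (leaves (spine ds xs t)) = mset xs + mset (leaves t)"
  by (induction ds xs t rule: spine.induct) auto

lemma sem_spine_append: "length xs = length ds \<Longrightarrow> sem (spine ds xs t) (ds @ w) = sem t w"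
  by (induction ds xs t rule: spine.induct) auto

lemma sem_spine_side_words:
  "length xs = length ds \<Longrightarrow> i < length xs \<Longrightarrow> sem (spine ds xs t) (side_words ds ! i) = Some (xs ! i)"
proof (induction ds xs t arbitrary: i rule: spine.induct)
  case (1 ds x xs t)
  then show ?case by (cases i) auto
next
  case (2 ds x xs t)
  then show ?case by (cases i) auto
qed auto

lemma dom_sem_spine:
  assumes "length xs = length ds" shows "dom (sem (spine ds xs (N (L p) (L q)))) = {w. \<not> prefix w ds}"
proof -
  have "sem (spine ds xs (N (L p) (L q))) w = None \<longleftrightarrow> prefix w ds" for w
    using assms
  proof (induction ds arbitrary: w xs)
    case Nil
    show ?case
    proof (cases w)
      case (Cons c w')
      then show ?thesis by (cases c) auto
    qed simp
  next
    case (Cons d ds)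
    then obtain x xs' where xs: "xs = x # xs'" "length xs' = length ds" by (cases xs) auto
    show ?case
    proof (cases w)
      case Nil
      then show ?thesis by (cases d) (simp_all add: xs)
    next
      case w: (Cons c w')
      from Cons.IH[OF xs(2), of w'] show ?thesis by (cases c; cases d) (auto simp: w xs)
    qed
  qed
  then show ?thesis by (auto simp: dom_def)
qed

text \<open>The two sibling leaves at the bottom of the spine are sent to siblings in reversed order, so no
  reduction of the table is possible.\<close>

definition spine_map :: "letter list \<Rightarrow> letter list \<Rightarrow> word list \<Rightarrow> (word \<rightharpoonup> word)" where
  "spine_map ds es xs = sem (spine ds xs (N (L (es @ [Lb])) (L (es @ [La]))))"

context
  fixes ds es :: "letter list" and xs :: "word list"
  assumes xs: "xs \<in> permutations_of_set (set (side_words es))" and len: "length es = length ds"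
begin

lemma mset_side_words: "mset xs = mset (side_words es)"
proof -
  have "distinct (side_words es)" using distinct_spine_words[of es] by (simp add: spine_words_def)
  then show ?thesis using permutations_of_setD[OF xs] by (metis set_eq_iff_mset_eq_distinct)
qed

lemma length_labels: "length xs = length ds"
  using arg_cong[OF mset_side_words, of size] by (simp add: len)

lemma spine_map_leaves:
  "mset (leaves (spine ds xs (N (L (es @ [Lb])) (L (es @ [La]))))) = mset (spine_words es)"
  by (simp add: leaves_spine[OF length_labels] mset_side_words spine_words_def)

lemma spine_map_leaves_set:
  "set (leaves (spine ds xs (N (L (es @ [Lb])) (L (es @ [La]))))) = set (spine_words es)"
  using spine_map_leaves by (rule mset_eq_setD)

lemma table_iso_spine_map: "table_iso (spine_map ds es xs)"
  unfolding spine_map_def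
  by (rule table_iso_sem)
    (simp_all add: spine_map_leaves_set prefix_code_spine_words cofin_spine_words
      mset_eq_imp_distinct_iff[OF spine_map_leaves] distinct_spine_words)

lemma dom_spine_map: "dom (spine_map ds es xs) = {w. \<not> prefix w ds}"
  unfolding spine_map_def by (rule dom_sem_spine[OF length_labels])

lemma ran_spine_map: "ran (spine_map ds es xs) = {w. \<not> prefix w es}"
  unfolding spine_map_def by (simp add: ran_sem spine_map_leaves_set ideal_generated_spine_words)

lemma closure_spine_map: "closure (spine_map ds es xs) = spine_map ds es xs"
proof (rule map_le_antisym)
  let ?g = "spine_map ds es xs"
  have i: "ideal_iso ?g" using table_iso_spine_map by (simp add: table_iso_def)
  show le: "?g \<subseteq>\<^sub>m closure ?g" by (rule map_le_closure[OF i])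
  have "dom (closure ?g) \<subseteq> dom ?g"
  proof
    fix w assume "w \<in> dom (closure ?g)"
    then obtain v where v: "closure ?g w = Some v" by auto
    show "w \<in> dom ?g"
    proof (rule ccontr)
      assume "w \<notin> dom ?g"
      then obtain x where x: "ds = w @ x" by (auto simp: dom_spine_map prefix_def)
      \<comment> \<open>A value at the prefix \<open>w\<close> of \<open>ds\<close> would make the
        image of \<open>ds @ [La]\<close> end in \<open>La\<close>, whereas the reversed bottom pair
        makes it end in \<open>Lb\<close>.\<close>
      have "closure ?g (w @ (x @ [La])) = Some (v @ (x @ [La]))"
        by (rule ideal_isoD(3)[OF ideal_iso_closure[OF i] v])
      moreover have "?g (ds @ [La]) = Some (es @ [Lb])"
        unfolding spine_map_def by (simp add: sem_spine_append[OF length_labels])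
      then have "closure ?g (ds @ [La]) = Some (es @ [Lb])"
        using le by (metis domI map_le_def)
      ultimately have "es @ [Lb] = (v @ x) @ [La]" by (simp add: x)
      then show False by simp
    qed
  qed
  with le show "closure ?g \<subseteq>\<^sub>m ?g" by (simp add: map_le_def subset_iff)
qed

lemma spine_map_carrier: "spine_map ds es xs \<in> carrier thompson_V"
  by (simp add: carrier_thompson_V table_iso_spine_map closure_spine_map)

lemma table_size_spine_map: "table_size (spine_map ds es xs) = length ds + 2"
proof -
  have "table_size (spine_map ds es xs) = card (min_words (ideal_generated (set (spine_words ds))))"
    by (simp add: table_size_eq[OF table_iso_spine_map] dom_spine_map ideal_generated_spine_words)
  also have "\<dots> = length (spine_words ds)"
    by (simp add: min_words_ideal_generated[OF prefix_code_spine_words] distinct_card distinct_spine_words)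
  finally show ?thesis by (simp add: spine_words_def)
qed

end

lemma prefix_set_inj: "{w. \<not> prefix w u} = {w. \<not> prefix w v} \<Longrightarrow> u = v"
proof -
  assume "{w. \<not> prefix w u} = {w. \<not> prefix w v}"
  then have "prefix w u \<longleftrightarrow> prefix w v" for w by blast
  from this[of u] this[of v] show "u = v" by (simp add: prefix_order.antisym)
qed

text \<open>The domain recovers \<open>ds\<close>, the range recovers \<open>es\<close>, and the
  values at the side addresses recover the permutation.\<close>

lemma spine_map_inj:
  assumes "xs \<in> permutations_of_set (set (side_words es))" "length es = length ds"
    and "xs' \<in> permutations_of_set (set (side_words es'))" "length es' = length ds'"
    and "spine_map ds es xs = spine_map ds' es' xs'"
  shows "ds = ds' \<and> es = es' \<and> xs = xs'"
proof -
  have ds: "ds = ds'"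
    by (rule prefix_set_inj)
      (use dom_spine_map[OF assms(1,2)] dom_spine_map[OF assms(3,4)] assms(5) in simp)
  have es: "es = es'"
    by (rule prefix_set_inj)
      (use ran_spine_map[OF assms(1,2)] ran_spine_map[OF assms(3,4)] assms(5) in simp)
  note l = length_labels[OF assms(1,2)] length_labels[OF assms(3,4)]
  have "xs = xs'"
  proof (rule nth_equalityI)
    fix i assume i: "i < length xs"
    have "Some (xs ! i) = spine_map ds es xs (side_words ds ! i)"
      unfolding spine_map_def by (rule sym, rule sem_spine_side_words) (use l i in auto)
    also have "\<dots> = spine_map ds' es' xs' (side_words ds ! i)" by (simp only: assms(5))
    also have "\<dots> = Some (xs' ! i)"
      unfolding spine_map_def ds by (rule sem_spine_side_words) (use l i ds in auto)
    finally show "xs ! i = xs' ! i" by simp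
  qed (use l ds in simp)
  with ds es show ?thesis by simp
qed

section \<open>Cardinality estimates\<close>

lemma UNIV_letter: "(UNIV :: letter set) = {La, Lb}"
  using letter.exhaust by auto

lemma card_letter_lists: "card {ds :: letter list. length ds = m} = 2 ^ m"
proof -
  have "finite (UNIV :: letter set)" "card (UNIV :: letter set) = 2" by (simp_all add: UNIV_letter)
  with card_lists_length_eq[of "UNIV :: letter set" m] show ?thesis by simp
qed

text \<open>The finiteness hypothesis keeps \<open>card\<close> from taking its default value
  0.\<close>

lemma card_table_size_ge:
  assumes "finite {g \<in> carrier thompson_V. table_size g = m + 2}"
  shows "4 ^ m * fact m \<le> card {g \<in> carrier thompson_V. table_size g = m + 2}"
proof -
  let ?W = "{ds :: letter list. length ds = m}"
  let ?P = "\<lambda>es. permutations_of_set (set (side_words es))"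
  let ?D = "?W \<times> Sigma ?W ?P"
  have fin: "finite ?W" using card_letter_lists[of m] by (metis card.infinite power_not_zero zero_neq_numeral)
  have cP: "card (?P es) = fact m" if "es \<in> ?W" for es
  proof -
    have "distinct (side_words es)" using distinct_spine_words[of es] by (simp add: spine_words_def)
    with that show ?thesis by (simp add: distinct_card)
  qed
  have "card ?D = 2 ^ m * (\<Sum>es\<in>?W. card (?P es))"
    using fin by (simp add: card_cartesian_product card_letter_lists)
  also have "(\<Sum>es\<in>?W. card (?P es)) = (\<Sum>es\<in>?W. fact m)" by (intro sum.cong refl cP)
  also have "\<dots> = 2 ^ m * fact m" by (simp add: card_letter_lists)
  also have "2 ^ m * (2 ^ m * fact m) = 4 ^ m * (fact m :: nat)"
    by (simp flip: power_mult_distrib mult.assoc)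
  finally have "4 ^ m * fact m = card ?D" by simp
  also have "\<dots> \<le> card {g \<in> carrier thompson_V. table_size g = m + 2}"
  proof (rule card_inj_on_le[where f = "\<lambda>(ds, es, xs). spine_map ds es xs"])
    show "inj_on (\<lambda>(ds, es, xs). spine_map ds es xs) ?D"
    proof (rule inj_onI)
      fix a b assume ab: "a \<in> ?D" "b \<in> ?D"
        "(case a of (ds, es, xs) \<Rightarrow> spine_map ds es xs) = (case b of (ds, es, xs) \<Rightarrow> spine_map ds es xs)"
      obtain ds es xs ds' es' xs' where eq: "a = (ds, es, xs)" "b = (ds', es', xs')"
        by (metis prod.exhaust)
      show "a = b" using spine_map_inj[of xs es ds xs' es' ds'] ab unfolding eq by simp
    qed
    show "(\<lambda>(ds, es, xs). spine_map ds es xs) ` ?D \<subseteq> {g \<in> carrier thompson_V. table_size g = m + 2}"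
      using spine_map_carrier table_size_spine_map by auto
  qed (rule assms)
  finally show ?thesis .
qed

text \<open>The n-th term of the exponential series at n is at most e^n.\<close>

lemma power_self_le: "real n ^ n \<le> 3 ^ n * fact n"
proof -
  have "real n ^ n /\<^sub>R fact n \<le> (\<Sum>k. real n ^ k /\<^sub>R fact k)"
    using sum_le_suminf[OF sums_summable[OF exp_converges[of "real n"]], of "{n}"] by simp
  also have "\<dots> = exp (real n * 1)" using exp_converges[of "real n"] by (simp add: sums_iff)
  also have "\<dots> = exp 1 ^ n" by (rule exp_of_nat_mult)
  also have "\<dots> \<le> 3 ^ n" by (intro power_mono exp_le) simp
  finally show ?thesis by (simp add: field_simps)
qed

lemma square_exp_bounded: "\<exists>B>0. \<forall>n. real n ^ 2 * (6 / 7) ^ n \<le> B"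
proof -
  have "(\<lambda>n. of_nat n * (13 / 14 :: real) ^ n) \<longlonglongrightarrow> 0"
    by (rule powser_times_n_limit_0) simp
  then have "Bseq (\<lambda>n. of_nat n * (13 / 14 :: real) ^ n)"
    by (intro convergent_imp_Bseq convergentI)
  then obtain K where K: "K > 0" "\<And>n. norm (of_nat n * (13 / 14 :: real) ^ n) \<le> K"
    by (auto elim: BseqE)
  have "real n ^ 2 * (6 / 7) ^ n \<le> K ^ 2" for n
  proof -
    \<comment> \<open>13/14 is chosen because its square 169/196 just exceeds 6/7 = 168/196.\<close>
    have "(6 / 7 :: real) ^ n \<le> ((13 / 14) ^ 2) ^ n" by (intro power_mono) (auto simp: power2_eq_square)
    then have "real n ^ 2 * (6 / 7) ^ n \<le> real n ^ 2 * ((13 / 14) ^ 2) ^ n" by (intro mult_left_mono) auto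
    also have "\<dots> = (real n * (13 / 14) ^ n) ^ 2" by (simp add: power_mult_distrib mult.commute flip: power_mult)
    also have "\<dots> \<le> K ^ 2" using K(2)[of n] by (intro power_mono) auto
    finally show ?thesis .
  qed
  with K(1) show ?thesis by (intro exI[of _ "K ^ 2"]) auto
qed

lemma sum_power_le: "2 \<le> (K::nat) \<Longrightarrow> (\<Sum>i\<le>n. K ^ i) \<le> 2 * K ^ n"
proof (induction n)
  case (Suc n)
  have "2 * K ^ n \<le> K * K ^ n" using Suc.prems by (intro mult_right_mono) auto
  then have "2 * K ^ n \<le> K ^ Suc n" by simp
  moreover have "(\<Sum>i\<le>n. K ^ i) \<le> 2 * K ^ n" by (rule Suc.IH[OF Suc.prems])
  ultimately show ?case unfolding sum.atMost_Suc by linarith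
qed simp

section \<open>Most elements have long words\<close>

context generating_set
begin

text \<open>There are at most 2|\<Delta>| letters, and 2|\<Delta>| to the power n log n, in that
  base, is n^n. The factor 2 accounts for all shorter words.\<close>

lemma card_short_words:
  assumes "finite \<Delta>" "\<Delta> \<noteq> {}" "1 \<le> n"
  shows "real (card {g \<in> carrier thompson_V. table_size g = n \<and>
     \<not> real (word_length thompson_V \<Delta> g) > real (table_size g) * log (real (2 * card \<Delta>)) (real (table_size g))})
     \<le> 2 * real n ^ n"
proof -
  let ?A = "sym_closure thompson_V \<Delta>"
  let ?K = "2 * card \<Delta>"
  let ?x = "real n * log (real ?K) (real n)"
  let ?bad = "{g \<in> carrier thompson_V. table_size g = n \<and>
     \<not> real (word_length thompson_V \<Delta> g) > real (table_size g) * log (real ?K) (real (table_size g))}"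
  define l where "l = nat \<lfloor>?x\<rfloor>"
  let ?W = "{ws. set ws \<subseteq> ?A \<and> length ws \<le> l}"
  have K: "2 \<le> ?K" using assms(1,2) by (simp add: Suc_le_eq card_gt_0_iff)
  have x: "0 \<le> ?x" using assms(3) K by (intro mult_nonneg_nonneg zero_le_log_cancel_iff[THEN iffD2]) auto
  have finA: "finite ?A" using assms(1) by simp
  have cA: "card ?A \<le> ?K"
    using card_Un_le[of \<Delta> "(\<lambda>d. inv\<^bsub>thompson_V\<^esub> d) ` \<Delta>"]
      card_image_le[OF assms(1), of "\<lambda>d. inv\<^bsub>thompson_V\<^esub> d"] by simp
  have "?bad \<subseteq> list_prod thompson_V ` ?W"
  proof
    fix g assume g: "g \<in> ?bad"
    obtain ws where ws: "set ws \<subseteq> ?A" "list_prod thompson_V ws = g"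
      "length ws = word_length thompson_V \<Delta> g"
      by (rule word_length_word[OF carr, of g]) (use g gen in auto)
    have "real (length ws) \<le> ?x" using g ws(3) by auto
    then have "length ws \<le> l" unfolding l_def by linarith
    with ws show "g \<in> list_prod thompson_V ` ?W" by auto
  qed
  then have "card ?bad \<le> card ?W"
    using finite_lists_length_le[OF finA] by (rule surj_card_le[rotated])
  also have "\<dots> = (\<Sum>i\<le>l. card ?A ^ i)" by (rule card_lists_length_le[OF finA])
  also have "\<dots> \<le> (\<Sum>i\<le>l. ?K ^ i)" by (intro sum_mono power_mono cA) auto
  also have "\<dots> \<le> 2 * ?K ^ l" by (rule sum_power_le[OF K])
  finally have "real (card ?bad) \<le> real (2 * ?K ^ l)" by (rule of_nat_mono)
  also have "\<dots> = 2 * real ?K powr real l" using K by (simp add: powr_realpow)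
  also have "\<dots> \<le> 2 * real ?K powr ?x"
  proof -
    have "real l \<le> ?x" unfolding l_def using x by simp
    then show ?thesis using K by (intro mult_left_mono powr_mono) auto
  qed
  also have "real ?K powr ?x = (real ?K powr log (real ?K) (real n)) powr real n"
    by (simp only: powr_powr mult.commute)
  also have "\<dots> = real n powr real n" using K assms(3) by (subst powr_log_cancel) auto
  also have "\<dots> = real n ^ n" using assms(3) by (simp add: powr_realpow)
  finally show ?thesis .
qed

lemma almost_all_long:
  assumes "finite \<Delta>"
  shows "almost_all_V (\<lambda>g. real (word_length thompson_V \<Delta> g)
     > real (table_size g) * log (real (2 * card \<Delta>)) (real (table_size g)))"
proof -
  let ?Q = "\<lambda>g. real (word_length thompson_V \<Delta> g)
     > real (table_size g) * log (real (2 * card \<Delta>)) (real (table_size g))"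
  let ?bad = "\<lambda>n. {g \<in> carrier thompson_V. table_size g = n \<and> \<not> ?Q g}"
  let ?all = "\<lambda>n. {g \<in> carrier thompson_V. table_size g = n}"
  have ne: "\<Delta> \<noteq> {}"
  proof
    assume "\<Delta> = {}"
    \<comment> \<open>For the empty path this map exchanges \<open>[La]\<close> and
      \<open>[Lb]\<close>, so \<open>V\<close> is not trivial.\<close>
    have "spine_map [] [] [] \<in> carrier thompson_V" "table_size (spine_map [] [] []) = 2"
      using spine_map_carrier[of "[]" "[]" "[]"] table_size_spine_map[of "[]" "[]" "[]"] by auto
    moreover have "carrier thompson_V = {\<one>\<^bsub>thompson_V\<^esub>}"
      using gen generate_empty by (simp add: \<open>\<Delta> = {}\<close>)
    ultimately show False using table_size_one by (simp add: one_thompson_V)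
  qed
  obtain B where B: "B > 0" "\<And>n. real n ^ 2 * (6 / 7) ^ n \<le> B" using square_exp_bounded by blast
  have "real (card (?bad n)) / real (card (?all n)) \<le> (32 * B + 2) * (7 / 8) ^ n" for n
  proof (cases "finite (?all n)")
    case False \<comment> \<open>impossible, but harmless: then \<open>card\<close> and hence the quotient are \<open>0\<close>\<close>
    have "0 \<le> (32 * B + 2) * (7 / 8) ^ n" using B(1) by simp
    with False show ?thesis by simp
  next
    case fin: True
    show ?thesis
    proof (cases "n < 2")
      case True
      have "card (?bad n) \<le> card (?all n)" by (rule card_mono[OF fin]) auto
      then have "real (card (?bad n)) / real (card (?all n)) \<le> 1" by (simp add: divide_le_eq)
      \<comment> \<open>Spine maps exist only from size 2 on. The trivial bound for smaller sizes is
        the source of the summand 2 in the constant.\<close>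
      also have "1 \<le> 2 * (7 / 8 :: real) ^ n" using True by (cases n) auto
      also have "\<dots> \<le> (32 * B + 2) * (7 / 8) ^ n" using B(1) by (intro mult_right_mono) auto
      finally show ?thesis .
    next
      case False
      then obtain m where m: "n = m + 2" by (metis add.commute le_Suc_ex not_less)
      have all: "4 ^ m * fact m \<le> real (card (?all n))"
        using of_nat_mono[where 'a = real, OF card_table_size_ge[of m]] fin by (simp add: m)
      have pos: "0 < (4 ^ m * fact m :: real)" by simp
      have "real (card (?bad n)) / real (card (?all n)) \<le> (2 * real n ^ n) / (4 ^ m * fact m)"
        using card_short_words[OF assms ne, of n] m all pos by (intro frac_le) auto
      \<comment> \<open>32 is 2 * 4^2, and passing from (n - 2)! to n! brings in n (n - 1).\<close>
      also have "\<dots> = 32 * (real n ^ n * (real (n * (n - 1)) / (4 ^ n * fact n)))"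
      proof -
        define D where "D = real (n * (n - 1))"
        have D: "D \<noteq> 0" unfolding D_def of_nat_eq_0_iff by (simp add: m)
        have f: "(fact n :: real) = D * fact m" by (simp add: D_def m algebra_simps)
        have p: "(4 :: real) ^ n = 16 * 4 ^ m" by (simp add: m)
        show ?thesis unfolding D_def[symmetric] f p using D by simp
      qed
      also have "\<dots> \<le> 32 * ((3 ^ n * fact n) * (real n ^ 2 / (4 ^ n * fact n)))"
        using power_self_le[of n]
        by (intro mult_left_mono mult_mono divide_right_mono)
          (auto simp: power2_eq_square of_nat_mult[symmetric] simp del: of_nat_mult)
      \<comment> \<open>The ratio 3/4 is factored so that 6/7 absorbs the square and 7/8 remains as
        the rate of decay.\<close>
      also have "\<dots> = 32 * (real n ^ 2 * (6 / 7 * (7 / 8)) ^ n)" by (simp add: power_divide)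
      also have "\<dots> = 32 * (real n ^ 2 * (6 / 7) ^ n) * (7 / 8) ^ n"
        by (simp only: power_mult_distrib mult.assoc)
      also have "\<dots> \<le> 32 * B * (7 / 8) ^ n" using B(2)[of n] by (intro mult_right_mono) auto
      also have "\<dots> \<le> (32 * B + 2) * (7 / 8) ^ n" by (simp add: algebra_simps)
      finally show ?thesis .
    qed
  qed
  then show ?thesis unfolding almost_all_V_def
    by (intro exI[of _ "32 * B + 2"] exI[of _ "7 / 8"]) (use B(1) in auto)
qed

end

theorem theorem3p8:
  fixes \<Delta> :: "(word \<rightharpoonup> word) set"
  assumes "finite \<Delta>"
    and "\<Delta> \<subseteq> carrier thompson_V"
    and "generate thompson_V \<Delta> = carrier thompson_V"
  shows "(\<exists>c c' :: real. c > 0 \<and> c' > 0 \<and>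
            (\<forall>g \<in> carrier thompson_V - {\<one>\<^bsub>thompson_V\<^esub>}.
               c' * real (table_size g) \<le> real (word_length thompson_V \<Delta> g) \<and>
               real (word_length thompson_V \<Delta> g)
                 \<le> c * real (table_size g) * log 2 (real (table_size g))))
       \<and> almost_all_V (\<lambda>g. real (word_length thompson_V \<Delta> g)
            > real (table_size g) * log (real (2 * card \<Delta>)) (real (table_size g)))"
proof -
  interpret V: generating_set \<Delta> by unfold_locales (fact assms)+
  from word_length_lower[OF assms] V.word_length_upper V.almost_all_long[OF assms(1)]
  show ?thesis by blast
qed

end
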